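(* Let $T>0$, $\sigma>0$, $r\in\mathbb{R}$ and let $0<L<U$, with $L<K<U$ and $L<S_0<U$. In the Black--Scholes model with initial asset price $S_0$, volatility $\sigma$ and interest rate $r$, let $C_{2B}(S_0,L,U,K,T,r,\sigma)=e^{-rT}\mathbb{E}_{\mathbb{P}^*}(X)$ be the price of the European double-barrier call option with maturity $T$, strike $K$, barriers $L,U$ and payoff $$X=(S_T-K)^+\,\mathbf{1}_{\{L<\min_{0\le t\le T}S_t\}}\,\mathbf{1}_{\{\max_{0\le t\le T}S_t<U\}}.$$ Put $y=\frac1\sigma\ln\left(\frac{U}{S_0}\right)$ and $z=\frac1\sigma\ln\left(\frac{L}{S_0}\right)$. Then $$C_{2B}(S_0,L,U,K,T,r,\sigma)=\sum_{k=-\infty}^{+\infty}C_{2B*}(k),$$ where $$\begin{aligned}C_{2B*}(k)={}&\exp\left(\left(\tfrac r\sigma-\tfrac12\sigma\right)2k(y-z)\right)\Big(C_{BS}(e^{2k\sigma(y-z)}S_0,K,T,r,\sigma)-C_{BS}(e^{2k\sigma(y-z)}S_0,U,T,r,\sigma)\\&\qquad-e^{-rT}(U-K)\,\Phi\left(\tfrac{2k(y-z)-y+(r/\sigma-\sigma/2)T}{\sqrt T}\right)\Big)\\&-\exp\left(\left(\tfrac r\sigma-\tfrac12\sigma\right)(2k(y-z)+2y)\right)\Big(C_{BS}(e^{2\sigma(k(y-z)+y)}S_0,K,T,r,\sigma)-C_{BS}(e^{2\sigma(k(y-z)+y)}S_0,U,T,r,\sigma)\\&\qquad-e^{-rT}(U-K)\,\Phi\left(\tfrac{2k(y-z)+y+(r/\sigma-\sigma/2)T}{\sqrt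 T}\right)\Big).\end{aligned}$$
   Context: $\Phi$ is the standard normal distribution function, $a^+=\max(a,0)$, and $\mathbf 1_A$ is the indicator of the event $A$. Black--Scholes model: under the real-world measure $\mathbb{P}$ the asset price satisfies $dS_t=\mu S_t\,dt+\sigma S_t\,dW^1_t$ with $W^1$ a Wiener process and $\mu\in\mathbb{R}$, and the bank account is $B_t=e^{rt}$. The risk-neutral measure $\mathbb{P}^*$ is the measure equivalent to $\mathbb{P}$ with density $\frac{d\mathbb{P}^*}{d\mathbb{P}}=\exp\left(\frac{r-\mu}{\sigma}W^1_T-\frac12\left(\frac{r-\mu}{\sigma}\right)^2T\right)$. Under $\mathbb{P}^*$, $S_t=S_0\exp\left((r-\frac12\sigma^2)t+\sigma W^2_t\right)$ for $0\le t\le T$, where $W^2$ is a $\mathbb{P}^*$-Wiener process. The price of a payoff $X$ paid at time $T$ is $e^{-rT}\mathbb{E}_{\mathbb{P}^*}(X)$. $C_{BS}(s,K,T,r,\sigma)$ denotes the Black--Scholes price of the European call with initial price $s>0$, strike $K$, maturity $T$, i.e. $C_{BS}(s,K,T,r,\sigma)=e^{-rT}\,\mathbb{E}\left[\left(s\,e^{(r-\sigma^2/2)T+\sigma\sqrt T\,Z}-K\right)^+\right]$ with $Z\sim N(0,1)$. *)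

theory Defs
  imports "HOL-Probability.Probability"
begin

text \<open>
  Paths are continuous for every \<open>\<omega>\<close>, not just almost every one, so that path functionals such as
  the running minimum are measurable without completing the probability space.
\<close>

locale wiener_process = prob_space M
  for M :: "'a measure" and W :: "real \<Rightarrow> 'a \<Rightarrow> real" +
  assumes random_variable: "\<And>t. 0 \<le> t \<Longrightarrow> W t \<in> borel_measurable M"
    and start_zero: "AE \<omega> in M. W 0 \<omega> = 0"
    and continuous_paths: "\<And>\<omega>. \<omega> \<in> space M \<Longrightarrow> continuous_on {0..} (\<lambda>t. W t \<omega>)"
    and normal_increments: "\<And>s t. 0 \<le> s \<Longrightarrow> s < t \<Longrightarrow>
      distributed M lborel (\<lambda>\<omega>. W t \<omega> - W s \<omega>) (normal_density 0 (sqrt (t - s)))"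
    and independent_increments: "\<And>(n::nat) \<tau>. 0 \<le> \<tau> 0 \<Longrightarrow> (\<And>i. i < n \<Longrightarrow> \<tau> i \<le> \<tau> (Suc i)) \<Longrightarrow>
      indep_vars (\<lambda>_. borel) (\<lambda>i \<omega>. W (\<tau> (Suc i)) \<omega> - W (\<tau> i) \<omega>) {..<n}"

text \<open>
  The strong solution of \<open>dS\<^sub>t = \<mu> S\<^sub>t dt + \<sigma> S\<^sub>t dW\<^sub>t\<close> with initial value \<open>s\<close>, driven by the
  Wiener process \<open>W\<close> of the real-world measure.
\<close>

definition bs_asset :: "real \<Rightarrow> real \<Rightarrow> real \<Rightarrow> (real \<Rightarrow> 'a \<Rightarrow> real) \<Rightarrow> real \<Rightarrow> 'a \<Rightarrow> real" where
  "bs_asset s \<mu> \<sigma> W t \<omega> = s * exp ((\<mu> - \<sigma>\<^sup>2 / 2) * t + \<sigma> * W t \<omega>)"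

definition risk_neutral_measure ::
    "'a measure \<Rightarrow> (real \<Rightarrow> 'a \<Rightarrow> real) \<Rightarrow> real \<Rightarrow> real \<Rightarrow> real \<Rightarrow> real \<Rightarrow> 'a measure" where
  "risk_neutral_measure P W \<mu> \<sigma> r T =
     density P (\<lambda>\<omega>. ennreal (exp ((r - \<mu>) / \<sigma> * W T \<omega> - 1 / 2 * ((r - \<mu>) / \<sigma>)\<^sup>2 * T)))"

definition price :: "'a measure \<Rightarrow> real \<Rightarrow> real \<Rightarrow> ('a \<Rightarrow> real) \<Rightarrow> real" where
  "price Q r T X = exp (- r * T) * (\<integral>\<omega>. X \<omega> \<partial>Q)"

text \<open>For continuous paths the infimum and supremum over \<open>{0..T}\<close> are the minimum and maximum.\<close>

definition double_barrier_call_payoff ::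
    "(real \<Rightarrow> 'a \<Rightarrow> real) \<Rightarrow> real \<Rightarrow> real \<Rightarrow> real \<Rightarrow> real \<Rightarrow> 'a \<Rightarrow> real" where
  "double_barrier_call_payoff S L U K T \<omega> =
     max (S T \<omega> - K) 0 *
     indicator {\<omega>. L < (INF t\<in>{0..T}. S t \<omega>)} \<omega> *
     indicator {\<omega>. (SUP t\<in>{0..T}. S t \<omega>) < U} \<omega>"

abbreviation std_normal_cdf :: "real \<Rightarrow> real" ("\<Phi>") where
  "\<Phi> \<equiv> cdf std_normal_distribution"

definition C_BS :: "real \<Rightarrow> real \<Rightarrow> real \<Rightarrow> real \<Rightarrow> real \<Rightarrow> real" where
  "C_BS s K T r \<sigma> = exp (- r * T) *
     (\<integral>Z. max (s * exp ((r - \<sigma>\<^sup>2 / 2) * T + \<sigma> * sqrt T * Z) - K) 0 \<partial>std_normal_distribution)"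

end

theory Submission
  imports Defs
begin

text \<open>
  Under the real-world measure the logarithmic price, divided by the volatility, is a Wiener process
  with drift, and an explicit density turns expectations of it into driftless ones. Let \<open>g\<close> be the
  tilted payoff between the barriers \<open>z < y\<close> and \<open>G\<close> its extension to the line that is odd about
  both \<open>z\<close> and \<open>y\<close>. The heat flow of \<open>G\<close> vanishes at the barriers for all times, so optional
  stopping at the exit time shows that paths which hit a barrier contribute nothing to the expectation
  of \<open>G\<close> at maturity; this expectation is therefore the price. Since \<open>G\<close> is an alternating sum of
  translates and reflections of \<open>g\<close>, it splits into a series of Gaussian integrals of \<open>g\<close>, each of
  which is a Black--Scholes expression.
\<close>

section \<open>Gaussian integrals and the heat flow\<close>

text \<open>\<open>G\<close> jumps at the upper barrier: \<open>g\<close> has a positive limit there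
  from below, because \<open>U > K\<close>, and oddness flips its sign beyond. Hence the heat flow
  is continuous up to that barrier only before maturity, and exits near \<open>T\<close> are the
  delicate point; limits at the exit time are taken path by path. The model supplies independent
  increments on finite time grids, with no filtration. The martingale property of the heat flow is
  therefore stated as integrals that vanish against the indicator of having stayed inside so far:
  for finitely many times and a closed interval, then for all times, then for the open interval. The
  period \<open>2 * (y - z)\<close> is the translation obtained by composing the reflections about
  the two barriers; this is the source of the image points in the series. No Wiener process under
  the risk-neutral measure is constructed: its density is split into the factor that removes the
  real-world drift and the exponential tilt placed inside \<open>g\<close>, and \<open>\<mu>\<close>
  disappears with the first factor.\<close>

lemma integral_std_normal_distribution:
  fixes f :: "real \<Rightarrow> real"
  assumes "f \<in> borel_measurable borel"
  shows "(\<integral>v. f v \<partial>std_normal_distribution) = (\<integral>v. std_normal_density v * f v \<partial>lborel)"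
  using assms by (subst integral_density) auto

lemma integrable_std_normal_distribution:
  fixes f :: "real \<Rightarrow> real"
  assumes "f \<in> borel_measurable borel"
  shows "integrable std_normal_distribution f \<longleftrightarrow> integrable lborel (\<lambda>v. std_normal_density v * f v)"
  using assms by (subst integrable_density) auto

lemma integral_std_normal_distribution_uminus:
  fixes f :: "real \<Rightarrow> real"
  assumes [measurable]: "f \<in> borel_measurable borel"
  shows "(\<integral>v. f (- v) \<partial>std_normal_distribution) = (\<integral>v. f v \<partial>std_normal_distribution)"
  using lborel_integral_real_affine[of "-1" "\<lambda>v. std_normal_density v * f v" 0]
  by (simp add: integral_std_normal_distribution) (simp add: std_normal_density_def)

section \<open>Exponential tilting of the standard normal law\<close>

lemma std_normal_density_tilt:
  "std_normal_density (v + b) * exp (b * (v + b) - b\<^sup>2 / 2) = std_normal_density v"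
proof -
  have "- (v + b)\<^sup>2 / 2 + (b * (v + b) - b\<^sup>2 / 2) = - v\<^sup>2 / 2"
    by (simp add: power2_eq_square field_simps)
  then show ?thesis
    by (simp add: std_normal_density_def flip: exp_add)
qed

text \<open>Cameron-Martin formula in dimension one, by completing the square. It serves twice: to
  remove the drift from an increment, and to recover the Black-Scholes integrand from the tilted
  payoff.\<close>

lemma integral_std_normal_distribution_tilt:
  fixes f :: "real \<Rightarrow> real"
  assumes [measurable]: "f \<in> borel_measurable borel"
  shows "(\<integral>v. exp (b * v - b\<^sup>2 / 2) * f v \<partial>std_normal_distribution)
       = (\<integral>v. f (v + b) \<partial>std_normal_distribution)"
proof -
  have "(\<integral>v. exp (b * v - b\<^sup>2 / 2) * f v \<partial>std_normal_distribution)
      = (\<integral>v. (std_normal_density (v + b) * exp (b * (v + b) - b\<^sup>2 / 2)) * f (v + b) \<partial>lborel)"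
    using lborel_integral_real_affine[of 1 "\<lambda>v. std_normal_density v * (exp (b * v - b\<^sup>2 / 2) * f v)" b]
    by (simp add: integral_std_normal_distribution ac_simps)
  then show ?thesis
    unfolding std_normal_density_tilt by (simp add: integral_std_normal_distribution)
qed

lemma integrable_std_normal_distribution_exp:
  "integrable std_normal_distribution (\<lambda>v. exp (b * v))"
proof -
  have "integrable lborel (\<lambda>v. std_normal_density (v + b) * exp (b * (v + b) - b\<^sup>2 / 2))"
    unfolding std_normal_density_tilt by (rule integrable_normal_density) simp
  then have "integrable lborel (\<lambda>v. std_normal_density v * exp (b * v - b\<^sup>2 / 2))"
    using lborel_integrable_real_affine_iff[of 1 "\<lambda>v. std_normal_density v * exp (b * v - b\<^sup>2 / 2)" b]
    by (simp add: ac_simps)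
  then have "integrable std_normal_distribution (\<lambda>v. exp (b\<^sup>2 / 2) * exp (b * v - b\<^sup>2 / 2))"
    by (intro integrable_mult_right) (simp add: integrable_std_normal_distribution)
  then show ?thesis
    by (simp add: exp_diff)
qed

lemma normal_density_scale:
  assumes "a > 0"
  shows "normal_density 0 a (a * v) = std_normal_density v / a"
  using assms by (simp add: normal_density_def power_mult_distrib real_sqrt_mult)

lemma integral_normal_density_scale:
  fixes f :: "real \<Rightarrow> real"
  assumes [measurable]: "f \<in> borel_measurable borel" and "a > 0"
  shows "(\<integral>x. normal_density 0 a x * f x \<partial>lborel) = (\<integral>v. f (a * v) \<partial>std_normal_distribution)"
proof -
  have "(\<integral>x. normal_density 0 a x * f x \<partial>lborel)
      = a * (\<integral>v. normal_density 0 a (a * v) * f (a * v) \<partial>lborel)"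
    using lborel_integral_real_affine[of a "\<lambda>x. normal_density 0 a x * f x" 0] \<open>a > 0\<close> by simp
  then show ?thesis
    using \<open>a > 0\<close> by (simp add: normal_density_scale integral_std_normal_distribution
        del: std_normal_density_def)
qed

lemma integrable_normal_density_scale:
  fixes f :: "real \<Rightarrow> real"
  assumes [measurable]: "f \<in> borel_measurable borel" and "a > 0"
  shows "integrable lborel (\<lambda>x. normal_density 0 a x * f x)
     \<longleftrightarrow> integrable std_normal_distribution (\<lambda>v. f (a * v))"
proof -
  have "integrable lborel (\<lambda>x. normal_density 0 a x * f x)
     \<longleftrightarrow> integrable lborel (\<lambda>v. normal_density 0 a (a * v) * f (a * v))"
    using lborel_integrable_real_affine_iff[of a "\<lambda>x. normal_density 0 a x * f x" 0] \<open>a > 0\<close> by simp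
  then show ?thesis
    using \<open>a > 0\<close> by (simp add: normal_density_scale integrable_std_normal_distribution
        integrable_mult_right_iff[of lborel _ "1 / a", simplified])
qed

interpretation std_normal: prob_space std_normal_distribution
  by (rule prob_space_normal_density) simp

lemma integral_std_normal_distribution_const:
  "(\<integral>v. (c::real) \<partial>std_normal_distribution) = c"
  using std_normal.prob_space by simp

lemma integrable_std_normal_distribution_bounded:
  fixes f :: "real \<Rightarrow> real"
  assumes [measurable]: "f \<in> borel_measurable borel" and "\<And>x. \<bar>f x\<bar> \<le> C"
  shows "integrable std_normal_distribution f"
  using assms by (intro std_normal.integrable_const_bound[of _ C]) auto

text \<open>This makes countably many jumps of the datum invisible to the heat flow at positive
  times.\<close>

lemma AE_std_normal_distribution_affine_notin:
  assumes "countable A" and "(b::real) \<noteq> 0"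
  shows "AE v in std_normal_distribution. a + b * v \<notin> A"
proof -
  have "{v. a + b * v \<in> A} \<subseteq> (\<lambda>x. (x - a) / b) ` A"
    using assms(2) by (auto simp: image_iff intro!: bexI[rotated])
  then have "countable {v. a + b * v \<in> A}"
    using assms(1) by (meson countable_image countable_subset)
  then have "AE v in lborel. v \<notin> {v. a + b * v \<in> A}"
    by (intro AE_not_in countable_imp_null_set_lborel)
  then show ?thesis
    by (subst AE_density) auto
qed

text \<open>The heat semigroup: the mean of \<open>G\<close> at a Wiener process started in
  \<open>x\<close>, after time \<open>s\<close>. In this form \<open>s = 0\<close> returns
  \<open>G\<close> itself, jumps included.\<close>

definition heat :: "(real \<Rightarrow> real) \<Rightarrow> real \<Rightarrow> real \<Rightarrow> real" where
  "heat G s x = (\<integral>v. G (x + sqrt s * v) \<partial>std_normal_distribution)"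

lemma heat_0 [simp]: "heat G 0 x = G x"
  unfolding heat_def by (simp only: real_sqrt_zero mult_zero_left add_0_right integral_std_normal_distribution_const)

lemma borel_measurable_heat [measurable]:
  assumes [measurable]: "G \<in> borel_measurable borel"
  shows "heat G s \<in> borel_measurable borel"
  unfolding heat_def by measurable

lemma heat_bounded:
  assumes "G \<in> borel_measurable borel" and "\<And>x. \<bar>G x\<bar> \<le> C"
  shows "\<bar>heat G s x\<bar> \<le> C"
proof -
  have "integrable std_normal_distribution (\<lambda>v. G (x + sqrt s * v))"
    using assms by (intro integrable_std_normal_distribution_bounded[of _ C]) auto
  then have "\<bar>heat G s x\<bar> \<le> (\<integral>v. C \<partial>std_normal_distribution)"
    unfolding heat_def using assms(2)
    by (intro integral_abs_bound[THEN order_trans] integral_mono) auto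
  then show ?thesis by (simp only: integral_std_normal_distribution_const)
qed

text \<open>The normal law is symmetric, so changing the sign of \<open>v\<close> equates the
  integral with its own negative.\<close>

lemma heat_odd:
  assumes [measurable]: "G \<in> borel_measurable borel" and odd: "\<And>x. G (2 * a - x) = - G x"
  shows "heat G s a = 0"
proof -
  have "heat G s a = (\<integral>v. G (a + sqrt s * - v) \<partial>std_normal_distribution)"
    unfolding heat_def by (subst integral_std_normal_distribution_uminus[symmetric]) auto
  also have "\<dots> = (\<integral>v. - G (a + sqrt s * v) \<partial>std_normal_distribution)"
    using odd[of "a + sqrt s * v" for v] by (simp add: algebra_simps)
  also have "\<dots> = - heat G s a" by (simp add: heat_def)
  finally show ?thesis by simp
qed

text \<open>Since \<open>s0 > 0\<close>, almost every \<open>x0 + sqrt s0 * v\<close> is a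
  continuity point of \<open>G\<close>, and boundedness gives dominated convergence. At
  \<open>s0 = 0\<close> the claim would amount to continuity of \<open>G\<close>.\<close>

lemma tendsto_heat:
  assumes [measurable]: "G \<in> borel_measurable borel" and bounded: "\<And>x. \<bar>G x\<bar> \<le> C"
    and discont: "countable {x. \<not> isCont G x}"
    and "x \<longlonglongrightarrow> x0" "s \<longlonglongrightarrow> s0" "s0 > 0"
  shows "(\<lambda>n. heat G (s n) (x n)) \<longlonglongrightarrow> heat G s0 x0"
  unfolding heat_def
proof (rule integral_dominated_convergence[where w="\<lambda>_. C"])
  have "AE v in std_normal_distribution. x0 + sqrt s0 * v \<notin> {x. \<not> isCont G x}"
    using \<open>s0 > 0\<close> by (intro AE_std_normal_distribution_affine_notin discont) auto
  then show "AE v in std_normal_distribution.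
      (\<lambda>n. G (x n + sqrt (s n) * v)) \<longlonglongrightarrow> G (x0 + sqrt s0 * v)"
  proof eventually_elim
    case (elim v)
    then show ?case
      using assms(4,5) by (intro isCont_tendsto_compose[of _ G] tendsto_intros) auto
  qed
qed (use bounded in auto)

section \<open>Odd extension across two barriers\<close>

text \<open>Each \<open>x\<close> is moved into the cell from \<open>z\<close> to
  \<open>z + p\<close> before \<open>g\<close> is applied. For \<open>g\<close> supported in one
  cell this equals the sum of all translates, with bounds and measurability immediate.\<close>

definition periodize :: "real \<Rightarrow> real \<Rightarrow> (real \<Rightarrow> real) \<Rightarrow> real \<Rightarrow> real" where
  "periodize p z g x = g (x - p * of_int \<lfloor>(x - z) / p\<rfloor>)"

lemma periodize_shift:
  assumes "p > 0" shows "periodize p z g (x + p) = periodize p z g x"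
proof -
  have "\<lfloor>(x + p - z) / p\<rfloor> = \<lfloor>(x - z) / p\<rfloor> + 1"
    using floor_add_int[of "(x - z) / p" 1] assms by (simp add: field_simps)
  then show ?thesis by (simp add: periodize_def algebra_simps)
qed

lemma borel_measurable_periodize [measurable]:
  assumes [measurable]: "g \<in> borel_measurable borel"
  shows "periodize p z g \<in> borel_measurable borel"
  unfolding periodize_def by measurable

text \<open>Away from the cell ends the floor is locally constant, so the function is locally a
  translate of \<open>g\<close>.\<close>

lemma countable_discontinuities_periodize:
  assumes "p > 0" and "countable {x. \<not> isCont g x}"
  shows "countable {x. \<not> isCont (periodize p z g) x}"
proof (rule countable_subset)
  show "countable (range (\<lambda>k::int. z + p * k) \<union>
      (\<Union>k::int. (\<lambda>x. x + p * k) ` {x. \<not> isCont g x}))"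
    using assms(2) by auto
  show "{x. \<not> isCont (periodize p z g) x} \<subseteq> range (\<lambda>k::int. z + p * k) \<union>
      (\<Union>k::int. (\<lambda>x. x + p * k) ` {x. \<not> isCont g x})"
  proof (rule subsetI, rule ccontr)
    fix x assume x: "x \<in> {x. \<not> isCont (periodize p z g) x}"
      and notin: "x \<notin> range (\<lambda>k::int. z + p * k) \<union>
        (\<Union>k::int. (\<lambda>x. x + p * k) ` {x. \<not> isCont g x})"
    define n where "n = \<lfloor>(x - z) / p\<rfloor>"
    have "(x - z) / p \<notin> \<int>"
    proof
      assume "(x - z) / p \<in> \<int>"
      then obtain k where "(x - z) / p = of_int k" by (auto elim: Ints_cases)
      then have "x = z + p * of_int k" using \<open>p > 0\<close> by (simp add: field_simps)
      then show False using notin by auto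
    qed
    then have "\<forall>\<^sub>F u in nhds x. \<lfloor>(u - z) / p\<rfloor> = n"
      unfolding n_def by (rule eventually_floor_eq[rotated]) (use \<open>p > 0\<close> in \<open>auto intro!: tendsto_divide tendsto_diff filterlim_ident\<close>)
    then have "\<forall>\<^sub>F u in nhds x. periodize p z g u = g (u - p * of_int n)"
      by eventually_elim (simp add: periodize_def)
    moreover have "isCont g (x - p * of_int n)"
    proof (rule ccontr)
      assume "\<not> isCont g (x - p * of_int n)"
      then have "x \<in> (\<lambda>x. x + p * of_int n) ` {x. \<not> isCont g x}"
        by (intro image_eqI[of _ _ "x - p * of_int n"]) auto
      then show False using notin by auto
    qed
    then have "isCont (\<lambda>u. g (u - p * of_int n)) x"
      by (intro isCont_o2[of _ "\<lambda>u. u - p * of_int n" g]) auto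
    ultimately show False using x by (simp add: isCont_cong)
  qed
qed

text \<open>The window from \<open>z\<close> to \<open>y\<close> is no longer than the period, so at
  most one translate of \<open>x\<close> falls inside it.\<close>

lemma has_sum_periodize:
  fixes p x :: real
  assumes "p > 0" and "y \<le> z + p" and zero: "\<And>x. x \<le> z \<or> y \<le> x \<Longrightarrow> g x = 0"
  shows "((\<lambda>k::int. g (x + p * k)) has_sum periodize p z g x) UNIV"
proof -
  define n where "n = - \<lfloor>(x - z) / p\<rfloor>"
  have "g (x + p * of_int k) = 0" if "k \<noteq> n" for k
  proof (rule zero, rule ccontr)
    assume "\<not> (x + p * of_int k \<le> z \<or> y \<le> x + p * of_int k)"
    then have "z < x + p * of_int k" "x + p * of_int k < z + p" using assms(2) by auto
    then have "of_int (- k) \<le> (x - z) / p" "(x - z) / p < of_int (- k) + 1"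
      using \<open>p > 0\<close> by (auto simp: field_simps)
    then have "\<lfloor>(x - z) / p\<rfloor> = - k" by (rule floor_unique)
    then show False using that by (simp add: n_def)
  qed
  then have "((\<lambda>k::int. g (x + p * k)) has_sum (\<Sum>k\<in>{n}. g (x + p * of_int k))) UNIV"
    by (intro has_sum_finite_neutralI[of "{n}"]) auto
  then show ?thesis by (simp add: periodize_def n_def)
qed

text \<open>Method of images: a periodic function minus its reflection about \<open>y\<close> is odd
  about \<open>y\<close>, and this period makes it odd about \<open>z\<close> too.\<close>

definition odd_extension :: "real \<Rightarrow> real \<Rightarrow> (real \<Rightarrow> real) \<Rightarrow> real \<Rightarrow> real" where
  "odd_extension z y g x = periodize (2 * (y - z)) z g x - periodize (2 * (y - z)) z g (2 * y - x)"

lemma odd_extension_reflect_upper: "odd_extension z y g (2 * y - x) = - odd_extension z y g x"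
  by (simp add: odd_extension_def)

text \<open>\<open>2 * z - x\<close> plus one period is \<open>2 * y - x\<close>, so periodicity
  carries the antisymmetry from one barrier to the other.\<close>

lemma odd_extension_reflect_lower:
  assumes "z < y" shows "odd_extension z y g (2 * z - x) = - odd_extension z y g x"
  using periodize_shift[of "2 * (y - z)" z g "2 * z - x"] periodize_shift[of "2 * (y - z)" z g x] assms
  by (simp add: odd_extension_def algebra_simps)

text \<open>The reflection of \<open>x\<close> about \<open>y\<close> lies in the upper half of the
  same cell, where \<open>g\<close> vanishes.\<close>

lemma odd_extension_inside:
  assumes "z < x" "x < y" and zero: "\<And>x. x \<le> z \<or> y \<le> x \<Longrightarrow> g x = 0"
  shows "odd_extension z y g x = g x"
proof -
  have "\<lfloor>(x - z) / (2 * (y - z))\<rfloor> = 0" "\<lfloor>(2 * y - x - z) / (2 * (y - z))\<rfloor> = 0"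
    using assms(1,2) by (auto simp: floor_eq_iff field_simps)
  then show ?thesis using assms(1,2) by (simp add: odd_extension_def periodize_def zero)
qed

lemma borel_measurable_odd_extension [measurable]:
  assumes [measurable]: "g \<in> borel_measurable borel"
  shows "odd_extension z y g \<in> borel_measurable borel"
  unfolding odd_extension_def by measurable

lemma odd_extension_bounded:
  assumes "\<And>x. \<bar>g x\<bar> \<le> C"
  shows "\<bar>odd_extension z y g x\<bar> \<le> 2 * C"
  unfolding odd_extension_def periodize_def
  by (rule abs_triangle_ineq4[THEN order_trans]) (use add_mono[OF assms assms] in simp)

lemma countable_discontinuities_odd_extension:
  assumes "z < y" and "countable {x. \<not> isCont g x}"
  shows "countable {x. \<not> isCont (odd_extension z y g) x}"
proof (rule countable_subset)
  let ?R = "periodize (2 * (y - z)) z g"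
  let ?A = "{x. \<not> isCont ?R x}"
  show "countable (?A \<union> (\<lambda>x. 2 * y - x) ` ?A)"
    using countable_discontinuities_periodize[of "2 * (y - z)" g z] assms by auto
  have "isCont (odd_extension z y g) x" if "isCont ?R x" "isCont ?R (2 * y - x)" for x
    unfolding odd_extension_def[abs_def]
    using that by (intro continuous_diff isCont_o2[of _ "\<lambda>x. 2 * y - x" ?R]) auto
  then show "{x. \<not> isCont (odd_extension z y g) x} \<subseteq> ?A \<union> (\<lambda>x. 2 * y - x) ` ?A"
    by (force simp: image_iff)
qed

section \<open>First exit of a continuous path\<close>

text \<open>Real-valued, so that it can be multiplied into integrands and differenced: the decrease
  between two times marks the paths that first leave \<open>A\<close> in between.\<close>

definition stays :: "real set \<Rightarrow> real \<Rightarrow> (real \<Rightarrow> real) \<Rightarrow> real" where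
  "stays A t x = (if \<forall>u\<in>{0..t}. x u \<in> A then 1 else 0)"

text \<open>For closed \<open>A\<close>, a path outside at time \<open>u\<close> is outside near
  \<open>u\<close>, so fine grids detect it. With \<open>A\<close> open, a path touching the
  boundary at a single moment can be missed.\<close>

lemma stays_grid_tendsto:
  assumes cont: "continuous_on {0..t} x" and "closed A" and "0 \<le> t"
  shows "(\<lambda>n. \<Prod>j<Suc (Suc n). indicator A (x (t * real j / real (Suc n)))) \<longlonglongrightarrow> stays A t x"
proof (cases "\<forall>u\<in>{0..t}. x u \<in> A")
  case True
  have "t * real j / real (Suc n) \<in> {0..t}" if "j < Suc (Suc n)" for j n
    using mult_left_mono[of "real j" "real (Suc n)" t] that \<open>0 \<le> t\<close> by (auto simp: field_simps)
  then have "(\<Prod>j<Suc (Suc n). indicator A (x (t * real j / real (Suc n)))) = (1::real)" for n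
    using True by (intro prod.neutral) (auto simp: indicator_def)
  then show ?thesis unfolding stays_def if_P[OF True] by (simp only: tendsto_const)
next
  case False
  then obtain u where u: "0 \<le> u" "u \<le> t" "x u \<notin> A" by auto
  \<comment> \<open>For \<open>t = 0\<close> division by zero gives \<open>c = 0\<close>, which
    still satisfies \<open>u = t * c\<close>.\<close>
  define c where "c = u / t"
  have c: "0 \<le> c" "c \<le> 1" "u = t * c"
    using u by (auto simp: c_def divide_le_eq_1)
  define j where "j n = nat \<lfloor>c * real (Suc n)\<rfloor>" for n
  have j: "real (j n) \<le> c * real (Suc n)" "c * real (Suc n) < real (j n) + 1" for n
    using c(1) unfolding j_def by (auto intro!: mult_nonneg_nonneg)
  have j_le: "j n \<le> Suc n" for n
  proof -
    have "c * real (Suc n) \<le> real (Suc n)" using mult_right_mono[OF c(2), of "real (Suc n)"] by simp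
    then show ?thesis using j(1)[of n] by linarith
  qed
  have "(\<lambda>n. real (j n) / real (Suc n)) \<longlonglongrightarrow> c"
  proof (rule real_tendsto_sandwich)
    show "\<forall>\<^sub>F n in sequentially. c - 1 / real (Suc n) \<le> real (j n) / real (Suc n)"
      using j(2) by (intro always_eventually allI)
        (simp add: diff_le_eq pos_le_divide_eq less_imp_le del: of_nat_Suc flip: add_divide_distrib)
    show "\<forall>\<^sub>F n in sequentially. real (j n) / real (Suc n) \<le> c"
      using j(1) by (intro always_eventually allI) (simp add: field_simps)
    show "(\<lambda>n. c - 1 / real (Suc n)) \<longlonglongrightarrow> c"
      using tendsto_diff[OF tendsto_const lim_inverse_n'[THEN LIMSEQ_Suc], of c] by simp
  qed simp
  then have "(\<lambda>n. t * (real (j n) / real (Suc n))) \<longlonglongrightarrow> t * c"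
    by (intro tendsto_mult tendsto_const)
  then have conv: "(\<lambda>n. t * real (j n) / real (Suc n)) \<longlonglongrightarrow> u"
    by (simp add: c(3))
  have "t * real (j n) / real (Suc n) \<in> {0..t}" for n
    using mult_left_mono[of "real (j n)" "real (Suc n)" t] j_le[of n] \<open>0 \<le> t\<close> by (auto simp: field_simps)
  then have "(\<lambda>n. x (t * real (j n) / real (Suc n))) \<longlonglongrightarrow> x u"
    using cont conv u by (intro continuous_on_tendsto_compose[of "{0..t}" x]) auto
  then have "\<forall>\<^sub>F n in sequentially. x (t * real (j n) / real (Suc n)) \<in> - A"
    using \<open>closed A\<close> u by (intro topological_tendstoD) auto
  then have "\<forall>\<^sub>F n in sequentially.
      (\<Prod>j<Suc (Suc n). indicator A (x (t * real j / real (Suc n)))) = (0::real)"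
  proof eventually_elim
    case (elim n)
    then show ?case
      using j_le[of n] by (intro prod_zero bexI[of _ "j n"]) auto
  qed
  then show ?thesis unfolding stays_def if_not_P[OF False] by (rule tendsto_eventually)
qed

text \<open>A path that stays in the open interval attains its extrema there, so a slightly smaller
  closed interval already contains it.\<close>

lemma stays_open_tendsto:
  assumes cont: "continuous_on {0..t} x" and "0 \<le> t"
  shows "(\<lambda>k. stays {z + 1 / real (Suc k)..y - 1 / real (Suc k)} t x) \<longlonglongrightarrow> stays {z<..<y} t x"
proof (cases "\<forall>u\<in>{0..t}. x u \<in> {z<..<y}")
  case True
  obtain a where a: "a \<in> {0..t}" "\<And>u. u \<in> {0..t} \<Longrightarrow> x a \<le> x u"
    using continuous_attains_inf[OF compact_Icc _ cont] \<open>0 \<le> t\<close> by auto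
  obtain b where b: "b \<in> {0..t}" "\<And>u. u \<in> {0..t} \<Longrightarrow> x u \<le> x b"
    using continuous_attains_sup[OF compact_Icc _ cont] \<open>0 \<le> t\<close> by auto
  have null: "(\<lambda>k. 1 / real (Suc k)) \<longlonglongrightarrow> 0"
    using lim_inverse_n'[THEN LIMSEQ_Suc] by simp
  have "\<forall>\<^sub>F k in sequentially. 1 / real (Suc k) < min (x a - z) (y - x b)"
    using True a(1) b(1) by (intro order_tendstoD(2)[OF null]) auto
  then have "\<forall>\<^sub>F k in sequentially. stays {z + 1 / real (Suc k)..y - 1 / real (Suc k)} t x = 1"
  proof eventually_elim
    case (elim k)
    have "x u \<in> {z + 1 / real (Suc k)..y - 1 / real (Suc k)}" if "u \<in> {0..t}" for u
      using elim a(2)[OF that] b(2)[OF that] by auto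
    then show ?case unfolding stays_def by (intro if_P ballI)
  qed
  then show ?thesis using True by (simp add: stays_def tendsto_eventually)
next
  case False
  then obtain u where u: "u \<in> {0..t}" "x u \<notin> {z<..<y}" by blast
  have "x u \<notin> {z + 1 / real (Suc k)..y - 1 / real (Suc k)}" for k
  proof -
    have "0 < 1 / real (Suc k)" by simp
    then show ?thesis using u(2) unfolding atLeastAtMost_iff greaterThanLessThan_iff by linarith
  qed
  then have "stays {z + 1 / real (Suc k)..y - 1 / real (Suc k)} t x = 0" for k
    unfolding stays_def by (intro if_not_P) (use u(1) in blast)
  moreover have "stays {z<..<y} t x = 0"
    unfolding stays_def by (rule if_not_P[OF False])
  ultimately show ?thesis by (simp only: tendsto_const)
qed

text \<open>The times spent outside form a compact set, and \<open>\<tau>\<close> is its least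
  element. By the intermediate value theorem the path is then exactly on a barrier, as overshooting
  would force an earlier crossing.\<close>

lemma first_exit_exists:
  fixes x :: "real \<Rightarrow> real"
  assumes cont: "continuous_on {0..T} x" and start: "x 0 \<in> {z<..<y}"
    and exit: "\<not> (\<forall>u\<in>{0..T}. x u \<in> {z<..<y})"
  obtains \<tau> where "0 < \<tau>" "\<tau> \<le> T" "x \<tau> = z \<or> x \<tau> = y" "\<And>u. 0 \<le> u \<Longrightarrow> u < \<tau> \<Longrightarrow> x u \<in> {z<..<y}"
proof -
  define S where "S = {0..T} \<inter> x -` (- {z<..<y})"
  have "compact S"
    unfolding S_def compact_eq_bounded_closed
    by (intro conjI continuous_closed_preimage[OF cont]) (auto intro: bounded_Int)
  moreover have "S \<noteq> {}" using exit by (auto simp: S_def)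
  ultimately obtain \<tau> where \<tau>: "\<tau> \<in> S" "\<And>u. u \<in> S \<Longrightarrow> \<tau> \<le> u"
    by (metis compact_attains_inf)
  then have range: "0 \<le> \<tau>" "\<tau> \<le> T" and out: "x \<tau> \<notin> {z<..<y}" by (auto simp: S_def)
  have cont': "continuous_on {0..\<tau>} x"
    using range by (auto intro: continuous_on_subset[OF cont])
  have "x \<tau> = y" if above: "y \<le> x \<tau>"
  proof -
    obtain u where u: "0 \<le> u" "u \<le> \<tau>" "x u = y"
      using IVT'[of x 0 y \<tau>] above start range(1) cont' by (auto simp: less_imp_le)
    then have "\<tau> \<le> u" using range by (intro \<tau>(2)) (auto simp: S_def)
    then show ?thesis using u by simp
  qed
  moreover have "x \<tau> = z" if below: "x \<tau> \<le> z"
  proof -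
    obtain u where u: "0 \<le> u" "u \<le> \<tau>" "x u = z"
      using IVT2'[of x \<tau> z 0] below start range(1) cont' by (auto simp: less_imp_le)
    then have "\<tau> \<le> u" using range by (intro \<tau>(2)) (auto simp: S_def)
    then show ?thesis using u by simp
  qed
  ultimately have "x \<tau> = z \<or> x \<tau> = y" using out by auto
  moreover have "\<tau> \<noteq> 0" using out start by auto
  moreover have "x u \<in> {z<..<y}" if "0 \<le> u" "u < \<tau>" for u
    using \<tau>(2)[of u] that range by (auto simp: S_def)
  ultimately show ?thesis using range by (intro that[of \<tau>]) auto
qed

text \<open>
  Rounding the exit time up to a grid keeps it exact when it equals the maturity, so the value
  of the heat solution at the rounded exit time tends to its boundary value \<open>0\<close> even though the
  initial datum \<open>G\<close> may be discontinuous at the boundary.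
\<close>

lemma heat_at_grid_exit_tendsto:
  assumes "T > 0" and cont: "continuous_on {0..T} x" and start: "x 0 \<in> {z<..<y}"
    and [measurable]: "G \<in> borel_measurable borel" and bounded: "\<And>x. \<bar>G x\<bar> \<le> C"
    and discont: "countable {x. \<not> isCont G x}"
    and odd: "\<And>x. G (2 * z - x) = - G x" "\<And>x. G (2 * y - x) = - G x"
  defines "t \<equiv> \<lambda>n i. T * real i / real (Suc n)"
  shows "(\<lambda>n. \<Sum>i<Suc n. (stays {z<..<y} (t n i) x - stays {z<..<y} (t n (Suc i)) x)
            * heat G (T - t n (Suc i)) (x (t n (Suc i)))) \<longlonglongrightarrow> 0"
    (is "(\<lambda>n. ?Y n) \<longlonglongrightarrow> 0")
proof (cases "\<forall>u\<in>{0..T}. x u \<in> {z<..<y}")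
  case True
  have "t n i \<le> T" if "i \<le> Suc n" for n i
    using mult_left_mono[of "real i" "real (Suc n)" T] that \<open>T > 0\<close> by (auto simp: t_def field_simps)
  then have "stays {z<..<y} (t n i) x = 1" if "i \<le> Suc n" for n i
    using True that unfolding stays_def by (metis (no_types) atLeastAtMost_iff order_trans)
  then have "?Y n = 0" for n by (intro sum.neutral) auto
  then show ?thesis by simp
next
  case False
  then obtain \<tau> where \<tau>: "0 < \<tau>" "\<tau> \<le> T" and hit: "x \<tau> = z \<or> x \<tau> = y"
    and before: "\<And>u. 0 \<le> u \<Longrightarrow> u < \<tau> \<Longrightarrow> x u \<in> {z<..<y}"
    using first_exit_exists[OF cont start] by blast
  have stays: "stays {z<..<y} u x = (if u < \<tau> then 1 else 0)" if "0 \<le> u" for u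
    using hit before \<tau> that unfolding stays_def by (force simp: not_less)
  define c where "c = \<tau> / T"
  have c: "0 < c" "c \<le> 1" "\<tau> = T * c" using \<tau> \<open>T > 0\<close> by (auto simp: c_def)
  \<comment> \<open>The index with \<open>t n (j n) < \<tau> \<le> t n (Suc (j n))\<close>. Ceiling
    minus one, not floor, so that a grid point equal to \<open>\<tau>\<close> is the right end of
    its slot.\<close>
  define j where "j n = nat (\<lceil>c * real (Suc n)\<rceil> - 1)" for n
  have pos: "0 < c * real (Suc n)" for n using c(1) by simp
  have j: "real (j n) < c * real (Suc n)" "c * real (Suc n) \<le> real (j n) + 1" for n
    using pos[of n] unfolding j_def by linarith+
  have j_le: "j n < Suc n" for n
  proof -
    have "c * real (Suc n) \<le> real (Suc n)" using mult_right_mono[OF c(2), of "real (Suc n)"] by simp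
    then show ?thesis using j(1)[of n] by linarith
  qed
  have t_less: "t n i < \<tau> \<longleftrightarrow> i \<le> j n" for n i
  proof -
    have "t n i < \<tau> \<longleftrightarrow> real i < c * real (Suc n)"
      using \<open>T > 0\<close> by (simp add: t_def c(3) divide_less_eq mult.assoc del: of_nat_Suc)
    also have "\<dots> \<longleftrightarrow> i \<le> j n" using j[of n] by linarith
    finally show ?thesis .
  qed
  have Y: "?Y n = heat G (T - t n (Suc (j n))) (x (t n (Suc (j n))))" for n
  proof -
    have nonneg: "0 \<le> t n i" for i using \<open>T > 0\<close> by (simp add: t_def)
    have "stays {z<..<y} (t n i) x - stays {z<..<y} (t n (Suc i)) x = (if i = j n then 1 else 0)" for i
      by (auto simp: stays[OF nonneg] t_less)
    then have "?Y n = (\<Sum>i<Suc n. if i = j n then heat G (T - t n (Suc i)) (x (t n (Suc i))) else 0)"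
      by (intro sum.cong) auto
    also have "\<dots> = heat G (T - t n (Suc (j n))) (x (t n (Suc (j n))))"
      using j_le[of n] by (subst sum.delta) auto
    finally show ?thesis .
  qed
  have boundary: "heat G s (x \<tau>) = 0" for s
    using hit heat_odd[of G z s] heat_odd[of G y s] odd by auto
  show ?thesis
  proof (cases "\<tau> = T")
    case True
    then have "c = 1" using \<open>T > 0\<close> by (simp add: c_def)
    then have "j n = n" for n using j[of n] by auto
    then have "t n (Suc (j n)) = T" for n by (simp add: t_def)
    then have "?Y n = 0" for n unfolding Y using boundary[of 0] True by simp
    then show ?thesis by simp
  next
    case False
    have "(\<lambda>n. real (Suc (j n)) / real (Suc n)) \<longlonglongrightarrow> c"
    proof (rule real_tendsto_sandwich)
      show "\<forall>\<^sub>F n in sequentially. real (Suc (j n)) / real (Suc n) \<le> c + 1 / real (Suc n)"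
      proof (intro always_eventually allI)
        fix n
        have "real (j n) / real (Suc n) \<le> c"
          using j(1)[of n] by (simp add: pos_divide_le_eq del: of_nat_Suc)
        then show "real (Suc (j n)) / real (Suc n) \<le> c + 1 / real (Suc n)"
          by (simp only: of_nat_Suc[of "j n"] add_divide_distrib)
      qed
      show "\<forall>\<^sub>F n in sequentially. c \<le> real (Suc (j n)) / real (Suc n)"
        using j(2) by (intro always_eventually allI) (simp add: field_simps)
      show "(\<lambda>n. c + 1 / real (Suc n)) \<longlonglongrightarrow> c"
        using tendsto_add[OF tendsto_const lim_inverse_n'[THEN LIMSEQ_Suc], of c] by simp
    qed simp
    then have "(\<lambda>n. T * (real (Suc (j n)) / real (Suc n))) \<longlonglongrightarrow> T * c"
      by (intro tendsto_mult tendsto_const)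
    then have conv: "(\<lambda>n. t n (Suc (j n))) \<longlonglongrightarrow> \<tau>"
      by (simp add: c(3) t_def)
    have "t n (Suc (j n)) \<in> {0..T}" for n
      using mult_left_mono[of "real (Suc (j n))" "real (Suc n)" T] j_le[of n] \<open>T > 0\<close>
      by (auto simp: t_def field_simps)
    then have "(\<lambda>n. x (t n (Suc (j n)))) \<longlonglongrightarrow> x \<tau>"
      using cont conv \<tau> by (intro continuous_on_tendsto_compose[of "{0..T}" x]) auto
    then have "(\<lambda>n. heat G (T - t n (Suc (j n))) (x (t n (Suc (j n))))) \<longlonglongrightarrow> heat G (T - \<tau>) (x \<tau>)"
      using False \<tau> by (intro tendsto_heat[OF _ bounded discont] tendsto_intros conv) auto
    then show ?thesis unfolding Y boundary .
  qed
qed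

section \<open>Optional stopping for the heat flow along a drifted Wiener process\<close>

text \<open>Fubini on the joint law: freeze the first variable, average over the second. This takes
  the place of conditioning on the past.\<close>

lemma (in prob_space) expectation_indep_zero:
  fixes F :: "'b \<times> 'b \<Rightarrow> real"
  assumes indep: "indep_var N Y L V" and [measurable]: "F \<in> borel_measurable (N \<Otimes>\<^sub>M L)"
    and int: "integrable M (\<lambda>\<omega>. F (Y \<omega>, V \<omega>))"
    and zero: "\<And>y. y \<in> space N \<Longrightarrow> (\<integral>\<omega>. F (y, V \<omega>) \<partial>M) = 0"
  shows "(\<integral>\<omega>. F (Y \<omega>, V \<omega>) \<partial>M) = 0"
proof -
  have [measurable]: "Y \<in> measurable M N" "V \<in> measurable M L"
    and eq: "distr M N Y \<Otimes>\<^sub>M distr M L V = distr M (N \<Otimes>\<^sub>M L) (\<lambda>\<omega>. (Y \<omega>, V \<omega>))"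
    using indep unfolding indep_var_distribution_eq by auto
  interpret Y: prob_space "distr M N Y" by (rule prob_space_distr) simp
  interpret V: prob_space "distr M L V" by (rule prob_space_distr) simp
  interpret YV: pair_sigma_finite "distr M N Y" "distr M L V" ..
  have "integrable (distr M N Y \<Otimes>\<^sub>M distr M L V) F"
    unfolding eq using int by (simp add: integrable_distr_eq)
  then have "(\<integral>p. F p \<partial>(distr M N Y \<Otimes>\<^sub>M distr M L V))
      = (\<integral>y. (\<integral>v. F (y, v) \<partial>distr M L V) \<partial>distr M N Y)"
    by (rule YV.integral_fst'[symmetric])
  also have "\<dots> = (\<integral>y. 0 \<partial>distr M N Y)"
    by (intro Bochner_Integration.integral_cong refl) (simp add: integral_distr zero)
  finally show ?thesis
    unfolding eq by (simp add: integral_distr)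
qed

text \<open>Subtracting \<open>W 0\<close>, known to vanish only almost surely, makes every path
  start at zero and depend on increments alone. Time comes last so that a partial application is a
  path.\<close>

definition drifted :: "(real \<Rightarrow> 'a \<Rightarrow> real) \<Rightarrow> real \<Rightarrow> 'a \<Rightarrow> real \<Rightarrow> real" where
  "drifted W m \<omega> t = W t \<omega> - W 0 \<omega> + m * t"

text \<open>Weighting with this density removes the drift \<open>m\<close> up to time \<open>T\<close>.\<close>

definition drift_density :: "(real \<Rightarrow> 'a \<Rightarrow> real) \<Rightarrow> real \<Rightarrow> real \<Rightarrow> 'a \<Rightarrow> real" where
  "drift_density W m T \<omega> = exp (- m * (W T \<omega> - W 0 \<omega>) - m\<^sup>2 / 2 * T)"

section \<open>Removing the drift on finite time grids\<close>

context wiener_process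
begin

lemma borel_measurable_drifted:
  assumes "0 \<le> t" shows "(\<lambda>\<omega>. drifted W m \<omega> t) \<in> borel_measurable M"
  using random_variable[OF assms] random_variable[of 0] unfolding drifted_def by measurable

lemma continuous_on_drifted:
  assumes "\<omega> \<in> space M" shows "continuous_on {0..t} (drifted W m \<omega>)"
  unfolding drifted_def[abs_def]
  using continuous_on_subset[OF continuous_paths[OF assms], of "{0..t}"]
  by (intro continuous_intros) auto

lemma integral_increment:
  fixes f :: "real \<Rightarrow> real"
  assumes "0 \<le> s" "s < t" and [measurable]: "f \<in> borel_measurable borel"
  shows "(\<integral>\<omega>. f (W t \<omega> - W s \<omega>) \<partial>M) = (\<integral>v. f (sqrt (t - s) * v) \<partial>std_normal_distribution)"
proof -
  have "(\<integral>\<omega>. f (W t \<omega> - W s \<omega>) \<partial>M) = (\<integral>x. normal_density 0 (sqrt (t - s)) x * f x \<partial>lborel)"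
    using assms by (intro distributed_integral[symmetric, OF normal_increments]) auto
  then show ?thesis using assms by (simp add: integral_normal_density_scale)
qed

lemma borel_measurable_drift_density:
  assumes "0 \<le> T" shows "drift_density W m T \<in> borel_measurable M"
  using random_variable[OF assms] random_variable[of 0] unfolding drift_density_def[abs_def] by measurable

lemma integrable_drift_density:
  assumes "0 < T" shows "integrable M (drift_density W m T)"
proof -
  have "integrable std_normal_distribution (\<lambda>v. exp (- m * (sqrt T * v) - m\<^sup>2 / 2 * T))"
    using integrable_std_normal_distribution_exp[of "- m * sqrt T"] by (simp add: exp_diff mult.assoc)
  then have "integrable lborel (\<lambda>x. normal_density 0 (sqrt T) x * exp (- m * x - m\<^sup>2 / 2 * T))"
    using assms by (subst integrable_normal_density_scale) auto
  then show ?thesis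
    unfolding drift_density_def[abs_def]
    using assms distributed_integrable[OF normal_increments[of 0 T],
        where g="\<lambda>x. exp (- m * x - m\<^sup>2 / 2 * T)"] by simp
qed

lemma indep_var_past_increment:
  assumes "\<tau> 0 = 0" "\<And>i. i < n \<Longrightarrow> \<tau> i \<le> \<tau> (Suc i)" "\<tau> n \<le> T"
  shows "indep_var (PiM {..<n} (\<lambda>_. borel)) (\<lambda>\<omega>. \<lambda>i\<in>{..<n}. W (\<tau> (Suc i)) \<omega> - W (\<tau> i) \<omega>)
      (PiM {n} (\<lambda>_. borel)) (\<lambda>\<omega>. \<lambda>i\<in>{n}. W T \<omega> - W (\<tau> n) \<omega>)"
proof -
  \<comment> \<open>Appending \<open>T\<close> makes the increment from \<open>\<tau> n\<close> to
    \<open>T\<close> the last one of a single grid.\<close>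
  define \<sigma> where "\<sigma> = \<tau>(Suc n := T)"
  have "indep_vars (\<lambda>_. borel) (\<lambda>i \<omega>. W (\<sigma> (Suc i)) \<omega> - W (\<sigma> i) \<omega>) {..<Suc n}"
    using assms by (intro independent_increments) (auto simp: \<sigma>_def less_Suc_eq)
  then have "indep_var (PiM {..<n} (\<lambda>_. borel)) (\<lambda>\<omega>. \<lambda>i\<in>{..<n}. W (\<sigma> (Suc i)) \<omega> - W (\<sigma> i) \<omega>)
      (PiM {n} (\<lambda>_. borel)) (\<lambda>\<omega>. \<lambda>i\<in>{n}. W (\<sigma> (Suc i)) \<omega> - W (\<sigma> i) \<omega>)"
    by (rule indep_var_restrict) auto
  also have "(\<lambda>\<omega>. \<lambda>i\<in>{..<n}. W (\<sigma> (Suc i)) \<omega> - W (\<sigma> i) \<omega>)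
      = (\<lambda>\<omega>. \<lambda>i\<in>{..<n}. W (\<tau> (Suc i)) \<omega> - W (\<tau> i) \<omega>)"
    by (auto simp: \<sigma>_def fun_eq_iff restrict_def)
  also have "(\<lambda>\<omega>. \<lambda>i\<in>{n}. W (\<sigma> (Suc i)) \<omega> - W (\<sigma> i) \<omega>) = (\<lambda>\<omega>. \<lambda>i\<in>{n}. W T \<omega> - W (\<tau> n) \<omega>)"
    by (auto simp: \<sigma>_def fun_eq_iff restrict_def)
  finally show ?thesis .
qed

text \<open>Girsanov for one increment: the weight shifts its mean by \<open>- m * (t - s)\<close>,
  which cancels what the drift adds over the same time.\<close>

lemma integral_drift_increment:
  fixes f :: "real \<Rightarrow> real"
  assumes "0 \<le> s" "s < t" and [measurable]: "f \<in> borel_measurable borel"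
  shows "(\<integral>\<omega>. exp (- m * (W t \<omega> - W s \<omega>) - m\<^sup>2 / 2 * (t - s)) * f (W t \<omega> - W s \<omega>) \<partial>M)
      = (\<integral>v. f (sqrt (t - s) * v - m * (t - s)) \<partial>std_normal_distribution)"
proof -
  define b where "b = - m * sqrt (t - s)"
  have b: "- m * (sqrt (t - s) * v) - m\<^sup>2 / 2 * (t - s) = b * v - b\<^sup>2 / 2"
    "sqrt (t - s) * (v + b) = sqrt (t - s) * v - m * (t - s)" for v
    using assms by (auto simp: b_def power_mult_distrib algebra_simps)
  have "(\<integral>\<omega>. exp (- m * (W t \<omega> - W s \<omega>) - m\<^sup>2 / 2 * (t - s)) * f (W t \<omega> - W s \<omega>) \<partial>M)
      = (\<integral>v. exp (b * v - b\<^sup>2 / 2) * f (sqrt (t - s) * v) \<partial>std_normal_distribution)"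
    using integral_increment[OF assms(1,2), of "\<lambda>x. exp (- m * x - m\<^sup>2 / 2 * (t - s)) * f x"]
    unfolding b by simp
  also have "\<dots> = (\<integral>v. f (sqrt (t - s) * (v + b)) \<partial>std_normal_distribution)"
    by (rule integral_std_normal_distribution_tilt) simp
  finally show ?thesis unfolding b .
qed

lemma integrable_drift_density_mult:
  assumes "0 < T" and [measurable]: "f \<in> borel_measurable M"
    and bounded: "\<And>\<omega>. \<omega> \<in> space M \<Longrightarrow> \<bar>f \<omega>\<bar> \<le> C"
  shows "integrable M (\<lambda>\<omega>. drift_density W m T \<omega> * f \<omega>)"
proof (rule Bochner_Integration.integrable_bound)
  show "integrable M (\<lambda>\<omega>. C * drift_density W m T \<omega>)"
    using integrable_drift_density[OF \<open>0 < T\<close>] by simp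
  show "(\<lambda>\<omega>. drift_density W m T \<omega> * f \<omega>) \<in> borel_measurable M"
    using borel_measurable_drift_density[of T m] \<open>0 < T\<close>
    by (intro borel_measurable_times assms(2)) auto
  show "AE \<omega> in M. norm (drift_density W m T \<omega> * f \<omega>) \<le> norm (C * drift_density W m T \<omega>)"
  proof (rule AE_I2)
    fix \<omega> assume "\<omega> \<in> space M"
    have "\<bar>f \<omega>\<bar> \<le> \<bar>C\<bar>" using bounded[OF \<open>\<omega> \<in> space M\<close>] by simp
    then show "norm (drift_density W m T \<omega> * f \<omega>) \<le> norm (C * drift_density W m T \<omega>)"
      by (simp add: abs_mult drift_density_def mult.commute mult_right_mono)
  qed
qed

text \<open>Martingale property of the heat flow along the weighted path, tested on finitely many
  past positions. The product stops before \<open>n\<close>, so the evaluation time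
  \<open>\<tau> n\<close> may lie after all monitored times.\<close>

lemma expectation_heat_grid:
  assumes "0 < T" and \<tau>: "\<tau> 0 = 0" "\<And>i. i < n \<Longrightarrow> \<tau> i \<le> \<tau> (Suc i)" "\<tau> n \<le> T"
    and [measurable]: "G \<in> borel_measurable borel" and bounded: "\<And>x. \<bar>G x\<bar> \<le> C"
    and [measurable]: "A \<in> sets borel"
  shows "(\<integral>\<omega>. drift_density W m T \<omega> * ((\<Prod>j<n. indicator A (drifted W m \<omega> (\<tau> j))) *
      (G (drifted W m \<omega> T) - heat G (T - \<tau> n) (drifted W m \<omega> (\<tau> n)))) \<partial>M) = 0"
\<comment> \<open>With no time left \<open>heat G 0\<close> is \<open>G\<close> and the integrand is
  zero; the increment formula needs a positive duration.\<close>
proof (cases "\<tau> n = T")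
  case True
  then show ?thesis by simp
next
  case False
  define s where "s = T - \<tau> n"
  have "s > 0" using False \<tau>(3) by (simp add: s_def)
  have nonneg: "0 \<le> \<tau> j" if "j \<le> n" for j
    using that by (induction j) (use \<tau> in \<open>auto intro: order_trans\<close>)
  define N where "N = PiM {..<n} (\<lambda>_. borel :: real measure)"
  define Y where "Y = (\<lambda>\<omega>. \<lambda>i\<in>{..<n}. W (\<tau> (Suc i)) \<omega> - W (\<tau> i) \<omega>)"
  define L where "L = PiM {n} (\<lambda>_. borel :: real measure)"
  define V where "V = (\<lambda>\<omega>. \<lambda>i\<in>{n}. W T \<omega> - W (\<tau> n) \<omega>)"
  \<comment> \<open>Partial sums rebuild the positions from the vector of increments, which makes
    the monitored events functions of the past.\<close>
  define w where "w j y = (\<Sum>i<j. y i)" for j and y :: "nat \<Rightarrow> real"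
  have w_Y: "w j (Y \<omega>) = W (\<tau> j) \<omega> - W 0 \<omega>" if "j \<le> n" for j \<omega>
  proof -
    have "w j (Y \<omega>) = (\<Sum>i<j. W (\<tau> (Suc i)) \<omega> - W (\<tau> i) \<omega>)"
      unfolding w_def Y_def using that by (intro sum.cong) auto
    then show ?thesis using \<tau>(1) sum_lessThan_telescope[of "\<lambda>j. W (\<tau> j) \<omega>" j] by simp
  qed
  have w_meas: "w j \<in> borel_measurable N" if "j \<le> n" for j
    unfolding w_def[abs_def] N_def using that
    by (intro borel_measurable_sum measurable_component_singleton) auto
  define P where "P y = (\<Prod>j<n. indicator A (w j y + m * \<tau> j) :: real)" for y
  have [measurable]: "P \<in> borel_measurable N"
    unfolding P_def[abs_def]
  proof (intro borel_measurable_prod)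
    fix j assume "j \<in> {..<n}"
    then have [measurable]: "w j \<in> borel_measurable N" by (intro w_meas) auto
    show "(\<lambda>y. indicator A (w j y + m * \<tau> j) :: real) \<in> borel_measurable N" by measurable
  qed
  have [measurable]: "w n \<in> borel_measurable N" by (rule w_meas) simp
  have [measurable]: "(\<lambda>v. v n) \<in> borel_measurable L"
    unfolding L_def by (rule measurable_component_singleton) simp
  define F where "F = (\<lambda>(y, v). exp (- m * (w n y + v n) - m\<^sup>2 / 2 * T) * (P y *
      (G (w n y + v n + m * T) - heat G s (w n y + m * \<tau> n))))"
  have F_meas: "F \<in> borel_measurable (N \<Otimes>\<^sub>M L)"
    unfolding F_def by measurable
  have F_YV: "F (Y \<omega>, V \<omega>) = drift_density W m T \<omega> * ((\<Prod>j<n. indicator A (drifted W m \<omega> (\<tau> j))) *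
      (G (drifted W m \<omega> T) - heat G (T - \<tau> n) (drifted W m \<omega> (\<tau> n))))" for \<omega>
    unfolding F_def P_def by (simp add: w_Y V_def drift_density_def drifted_def s_def)
  have indep: "indep_var N Y L V"
    unfolding N_def L_def Y_def V_def by (rule indep_var_past_increment[OF \<tau>])
  have [measurable]: "Y \<in> measurable M N" "V \<in> measurable M L"
    using indep unfolding indep_var_distribution_eq by auto
  have P_le: "\<bar>P y\<bar> \<le> 1" for y
    unfolding P_def by (simp add: abs_prod prod_le_1 indicator_def)
  have "integrable M (\<lambda>\<omega>. drift_density W m T \<omega> * (P (Y \<omega>) *
      (G (w n (Y \<omega>) + V \<omega> n + m * T) - heat G s (w n (Y \<omega>) + m * \<tau> n))))"
  proof (rule integrable_drift_density_mult[OF \<open>0 < T\<close>])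
    fix \<omega>
    have "\<bar>G x - heat G s x'\<bar> \<le> 2 * C" for x x'
      using bounded[of x] heat_bounded[where G=G and s=s and x=x', OF _ bounded] by simp
    then show "\<bar>P (Y \<omega>) * (G (w n (Y \<omega>) + V \<omega> n + m * T) - heat G s (w n (Y \<omega>) + m * \<tau> n))\<bar> \<le> 1 * (2 * C)"
      unfolding abs_mult by (intro mult_mono P_le) auto
  qed measurable
  also have "(\<lambda>\<omega>. drift_density W m T \<omega> * (P (Y \<omega>) *
      (G (w n (Y \<omega>) + V \<omega> n + m * T) - heat G s (w n (Y \<omega>) + m * \<tau> n)))) = (\<lambda>\<omega>. F (Y \<omega>, V \<omega>))"
    by (simp add: F_def w_Y V_def drift_density_def)
  finally have F_int: "integrable M (\<lambda>\<omega>. F (Y \<omega>, V \<omega>))" .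
  \<comment> \<open>With the past frozen, the weight splits into a constant and the weight of the
    last increment; the latter cancels the drift and leaves the integral that defines
    \<open>heat G s x\<close>.\<close>
  have F_zero: "(\<integral>\<omega>. F (y, V \<omega>) \<partial>M) = 0" for y
  proof -
    define x where "x = w n y + m * \<tau> n"
    define K where "K = exp (- m * w n y - m\<^sup>2 / 2 * \<tau> n) * P y"
    have split: "exp (- m * (w n y + v) - m\<^sup>2 / 2 * T)
        = exp (- m * w n y - m\<^sup>2 / 2 * \<tau> n) * exp (- m * v - m\<^sup>2 / 2 * (T - \<tau> n))" for v
      by (simp add: field_simps flip: exp_add)
    have shift: "w n y + v + m * T = x + (v + m * s)" for v
      by (simp add: x_def s_def algebra_simps)
    have V_n: "V \<omega> n = W T \<omega> - W (\<tau> n) \<omega>" for \<omega> by (simp add: V_def)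
    have "F (y, V \<omega>) = K * (exp (- m * (W T \<omega> - W (\<tau> n) \<omega>) - m\<^sup>2 / 2 * (T - \<tau> n)) *
        (G (x + ((W T \<omega> - W (\<tau> n) \<omega>) + m * s)) - heat G s x))" for \<omega>
      unfolding F_def prod.case V_n split shift K_def x_def[symmetric] by (simp only: mult_ac)
    then have "(\<integral>\<omega>. F (y, V \<omega>) \<partial>M) = K * (\<integral>\<omega>. exp (- m * (W T \<omega> - W (\<tau> n) \<omega>) - m\<^sup>2 / 2 * (T - \<tau> n)) *
        (G (x + ((W T \<omega> - W (\<tau> n) \<omega>) + m * s)) - heat G s x) \<partial>M)"
      by simp
    also have "\<dots> = K * (\<integral>v. (G (x + ((sqrt (T - \<tau> n) * v - m * (T - \<tau> n)) + m * s)) - heat G s x)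
        \<partial>std_normal_distribution)"
      using \<open>s > 0\<close> nonneg[of n]
      by (subst integral_drift_increment[where f="\<lambda>u. G (x + (u + m * s)) - heat G s x"]) (auto simp: s_def)
    also have "\<dots> = K * (\<integral>v. (G (x + sqrt s * v) - heat G s x) \<partial>std_normal_distribution)"
      by (simp add: s_def)
    also have "\<dots> = K * (heat G s x - heat G s x)"
      using bounded integrable_std_normal_distribution_bounded[of "\<lambda>v. G (x + sqrt s * v)" C]
      by (subst Bochner_Integration.integral_diff)
        (simp_all only: heat_def[symmetric] integral_std_normal_distribution_const, auto)
    finally show ?thesis by simp
  qed
  show ?thesis
    using expectation_indep_zero[OF indep F_meas F_int F_zero] unfolding F_YV .
qed

end

section \<open>Measurability of staying in an interval at all times\<close>

lemma stays_bounded: "\<bar>stays A t x\<bar> \<le> 1"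
  by (simp add: stays_def)

lemma borel_measurable_stays_closed:
  assumes "0 \<le> t" and A: "closed A"
    and meas: "\<And>u. 0 \<le> u \<Longrightarrow> (\<lambda>\<omega>. X \<omega> u) \<in> borel_measurable M"
    and cont: "\<And>\<omega>. \<omega> \<in> space M \<Longrightarrow> continuous_on {0..t} (X \<omega>)"
  shows "(\<lambda>\<omega>. stays A t (X \<omega>)) \<in> borel_measurable M"
proof (rule borel_measurable_LIMSEQ_real)
  fix \<omega> assume "\<omega> \<in> space M"
  then show "(\<lambda>n. \<Prod>j<Suc (Suc n). indicator A (X \<omega> (t * real j / real (Suc n)))) \<longlonglongrightarrow> stays A t (X \<omega>)"
    by (rule stays_grid_tendsto[OF cont A \<open>0 \<le> t\<close>])
next
  have [measurable]: "A \<in> sets borel" using A by simp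
  fix n
  show "(\<lambda>\<omega>. \<Prod>j<Suc (Suc n). indicator A (X \<omega> (t * real j / real (Suc n))) :: real) \<in> borel_measurable M"
    using \<open>0 \<le> t\<close> by (intro borel_measurable_prod measurable_compose[OF meas]) auto
qed

lemma borel_measurable_stays_open:
  assumes "0 \<le> t"
    and meas: "\<And>u. 0 \<le> u \<Longrightarrow> (\<lambda>\<omega>. X \<omega> u) \<in> borel_measurable M"
    and cont: "\<And>\<omega>. \<omega> \<in> space M \<Longrightarrow> continuous_on {0..t} (X \<omega>)"
  shows "(\<lambda>\<omega>. stays {z<..<y} t (X \<omega>)) \<in> borel_measurable M"
  by (rule borel_measurable_LIMSEQ_real[OF stays_open_tendsto[OF cont \<open>0 \<le> t\<close>]
        borel_measurable_stays_closed[OF \<open>0 \<le> t\<close> _ meas cont]]) auto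

section \<open>From finite grids to continuous monitoring\<close>

context wiener_process
begin

lemma drift_density_dominated_convergence:
  assumes "0 < T" and [measurable]: "f \<in> borel_measurable M" "\<And>n. h n \<in> borel_measurable M"
    and lim: "\<And>\<omega>. \<omega> \<in> space M \<Longrightarrow> (\<lambda>n. h n \<omega>) \<longlonglongrightarrow> f \<omega>"
    and bounded: "\<And>n \<omega>. \<omega> \<in> space M \<Longrightarrow> \<bar>h n \<omega>\<bar> \<le> C"
  shows "(\<lambda>n. \<integral>\<omega>. drift_density W m T \<omega> * h n \<omega> \<partial>M) \<longlonglongrightarrow> (\<integral>\<omega>. drift_density W m T \<omega> * f \<omega> \<partial>M)"
proof (rule integral_dominated_convergence)
  have [measurable]: "drift_density W m T \<in> borel_measurable M"
    using \<open>0 < T\<close> by (intro borel_measurable_drift_density) simp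
  show "(\<lambda>\<omega>. drift_density W m T \<omega> * f \<omega>) \<in> borel_measurable M"
    "\<And>n. (\<lambda>\<omega>. drift_density W m T \<omega> * h n \<omega>) \<in> borel_measurable M" by measurable
  show "integrable M (\<lambda>\<omega>. drift_density W m T \<omega> * C)"
    using integrable_drift_density[OF \<open>0 < T\<close>] by simp
  show "AE \<omega> in M. (\<lambda>n. drift_density W m T \<omega> * h n \<omega>) \<longlonglongrightarrow> drift_density W m T \<omega> * f \<omega>"
    using lim by (intro AE_I2 tendsto_mult tendsto_const)
  show "AE \<omega> in M. norm (drift_density W m T \<omega> * h n \<omega>) \<le> drift_density W m T \<omega> * C" for n
    using bounded by (intro AE_I2) (simp add: abs_mult drift_density_def)
qed

text \<open>The horizon \<open>t'\<close> and the evaluation time \<open>t\<close> may differ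
  because the telescoping sum pairs a heat value with the indicators at its own grid time and at the
  preceding one.\<close>

lemma expectation_heat_stays:
  assumes "0 < T" and t: "0 \<le> t'" "t' \<le> t" "t \<le> T"
    and [measurable]: "G \<in> borel_measurable borel" and bounded: "\<And>x. \<bar>G x\<bar> \<le> C"
  shows "(\<integral>\<omega>. drift_density W m T \<omega> * (stays {z<..<y} t' (drifted W m \<omega>) *
      (G (drifted W m \<omega> T) - heat G (T - t) (drifted W m \<omega> t))) \<partial>M) = 0"
    (is "(\<integral>\<omega>. ?D \<omega> * (_ * ?Z \<omega>) \<partial>M) = 0")
proof -
  have [measurable]: "(\<lambda>\<omega>. drifted W m \<omega> T) \<in> borel_measurable M" "(\<lambda>\<omega>. drifted W m \<omega> t) \<in> borel_measurable M"
    using t by (auto intro: borel_measurable_drifted)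
  have Z [measurable]: "?Z \<in> borel_measurable M" by measurable
  have Z_le: "\<bar>?Z \<omega>\<bar> \<le> 2 * C" for \<omega>
    using bounded[of "drifted W m \<omega> T"] heat_bounded[where G=G and s="T - t" and x="drifted W m \<omega> t", OF _ bounded] by simp
  have le: "\<bar>a * ?Z \<omega>\<bar> \<le> 1 * (2 * C)" if "\<bar>a\<bar> \<le> 1" for a \<omega>
    unfolding abs_mult using that by (intro mult_mono Z_le) auto
  have closed: "(\<integral>\<omega>. ?D \<omega> * (stays {a..b} t' (drifted W m \<omega>) * ?Z \<omega>) \<partial>M) = 0" for a b
  proof -
    let ?P = "\<lambda>n \<omega>. \<Prod>j<Suc (Suc n). indicator {a..b} (drifted W m \<omega> (t' * real j / real (Suc n))) :: real"
    have P_meas: "?P n \<in> borel_measurable M" for n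
      using t(1) by (intro borel_measurable_prod measurable_compose[OF borel_measurable_drifted]) auto
    have "(\<lambda>n. \<integral>\<omega>. ?D \<omega> * (?P n \<omega> * ?Z \<omega>) \<partial>M)
        \<longlonglongrightarrow> (\<integral>\<omega>. ?D \<omega> * (stays {a..b} t' (drifted W m \<omega>) * ?Z \<omega>) \<partial>M)"
    proof (rule drift_density_dominated_convergence[OF \<open>0 < T\<close>])
      show "(\<lambda>\<omega>. stays {a..b} t' (drifted W m \<omega>) * ?Z \<omega>) \<in> borel_measurable M"
        using t by (intro borel_measurable_times borel_measurable_stays_closed Z borel_measurable_drifted
          continuous_on_drifted) auto
      show "(\<lambda>\<omega>. ?P n \<omega> * ?Z \<omega>) \<in> borel_measurable M" for n
        by (intro borel_measurable_times P_meas Z)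
      show "(\<lambda>n. ?P n \<omega> * ?Z \<omega>) \<longlonglongrightarrow> stays {a..b} t' (drifted W m \<omega>) * ?Z \<omega>" if "\<omega> \<in> space M" for \<omega>
        using t(1) that by (intro tendsto_mult tendsto_const stays_grid_tendsto continuous_on_drifted) auto
      have "\<bar>?P n \<omega>\<bar> \<le> 1" for n \<omega>
        unfolding abs_prod by (intro prod_le_1) (auto simp: indicator_def)
      then show "\<bar>?P n \<omega> * ?Z \<omega>\<bar> \<le> 1 * (2 * C)" for n \<omega>
        by (rule le)
    qed
    moreover have "(\<integral>\<omega>. ?D \<omega> * (?P n \<omega> * ?Z \<omega>) \<partial>M) = 0" for n
    proof -
      \<comment> \<open>The first \<open>n + 2\<close> points divide \<open>{0..t'}\<close> evenly;
        \<open>t\<close> follows as point \<open>Suc (Suc n)\<close>, evaluated but not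
        monitored.\<close>
      define \<tau> where "\<tau> j = (if j \<le> Suc n then t' * real j / real (Suc n) else t)" for j
      have "\<tau> i \<le> \<tau> (Suc i)" if "i < Suc (Suc n)" for i
      proof (cases "i < Suc n")
        case True
        then show ?thesis
          using t(1) by (auto simp: \<tau>_def intro!: divide_right_mono mult_left_mono)
      next
        case False
        then have "i = Suc n" using that by simp
        then show ?thesis using t by (simp add: \<tau>_def)
      qed
      moreover have "?P n \<omega> = (\<Prod>j<Suc (Suc n). indicator {a..b} (drifted W m \<omega> (\<tau> j)))" for \<omega>
        by (intro prod.cong) (auto simp: \<tau>_def)
      ultimately show ?thesis
        using expectation_heat_grid[OF \<open>0 < T\<close>, of \<tau> "Suc (Suc n)" G C "{a..b}" m] t bounded
        by (simp add: \<tau>_def del: prod.lessThan_Suc)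
    qed
    ultimately show ?thesis by (simp add: LIMSEQ_const_iff del: prod.lessThan_Suc)
  qed
  have "(\<lambda>k. \<integral>\<omega>. ?D \<omega> * (stays {z + 1 / real (Suc k)..y - 1 / real (Suc k)} t' (drifted W m \<omega>) * ?Z \<omega>) \<partial>M)
      \<longlonglongrightarrow> (\<integral>\<omega>. ?D \<omega> * (stays {z<..<y} t' (drifted W m \<omega>) * ?Z \<omega>) \<partial>M)"
    using t(1) by (intro drift_density_dominated_convergence[OF \<open>0 < T\<close>, where C="1 * (2 * C)"]
        borel_measurable_times borel_measurable_stays_closed borel_measurable_stays_open Z borel_measurable_drifted
        le stays_bounded tendsto_mult tendsto_const stays_open_tendsto continuous_on_drifted) auto
  then show ?thesis unfolding closed by (simp add: LIMSEQ_const_iff)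
qed

text \<open>Optional stopping on a grid: \<open>Y n\<close> is the heat value at the first grid time
  not before the exit, and zero without exit. Its weighted mean is the same for every
  \<open>n\<close>, yet \<open>Y n\<close> tends to zero on each path.\<close>

lemma expectation_stays_odd:
  assumes "0 < T" and "z < 0" "0 < y"
    and [measurable]: "G \<in> borel_measurable borel" and bounded: "\<And>x. \<bar>G x\<bar> \<le> C"
    and discont: "countable {x. \<not> isCont G x}"
    and odd: "\<And>x. G (2 * z - x) = - G x" "\<And>x. G (2 * y - x) = - G x"
  shows "(\<integral>\<omega>. drift_density W m T \<omega> * (stays {z<..<y} T (drifted W m \<omega>) * G (drifted W m \<omega> T)) \<partial>M)
       = heat G T 0"
proof -
  let ?D = "drift_density W m T"
  let ?X = "drifted W m"
  let ?s = "\<lambda>t \<omega>. stays {z<..<y} t (?X \<omega>)"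
  define t where "t n i = T * real i / real (Suc n)" for n i
  have nonneg: "0 \<le> t n i" for n i using \<open>0 < T\<close> by (simp add: t_def)
  have t_mono: "t n i \<le> t n (Suc i)" for n i
    using \<open>0 < T\<close> by (auto simp: t_def intro!: divide_right_mono mult_left_mono)
  have t_le: "t n i \<le> T" if "i \<le> Suc n" for n i
    using mult_left_mono[of "real i" "real (Suc n)" T] that \<open>T > 0\<close> by (auto simp: t_def field_simps)
  have X_meas [measurable]: "(\<lambda>\<omega>. ?X \<omega> T) \<in> borel_measurable M" "(\<lambda>\<omega>. ?X \<omega> (t n i)) \<in> borel_measurable M" for n i
    using nonneg \<open>0 < T\<close> by (auto intro: borel_measurable_drifted)
  have s_meas [measurable]: "?s T \<in> borel_measurable M" "?s (t n i) \<in> borel_measurable M" for n i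
    using nonneg \<open>0 < T\<close> by (auto intro!: borel_measurable_stays_open borel_measurable_drifted continuous_on_drifted)
  have start: "?X \<omega> 0 = 0" for \<omega> by (simp add: drifted_def)
  have C: "0 \<le> C" using bounded[of 0] by simp
  have h_le: "\<bar>heat G s x\<bar> \<le> C" for s x by (rule heat_bounded[OF _ bounded]) simp
  define Y where "Y n \<omega> = (\<Sum>i<Suc n. (?s (t n i) \<omega> - ?s (t n (Suc i)) \<omega>)
      * heat G (T - t n (Suc i)) (?X \<omega> (t n (Suc i))))" for n \<omega>
  have Y_meas [measurable]: "Y n \<in> borel_measurable M" for n unfolding Y_def by measurable
  have s_antimono: "?s (t n (Suc i)) \<omega> \<le> ?s (t n i) \<omega>" for n i \<omega>
    using t_mono[of n i] unfolding stays_def by (force intro: order_trans)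
  have s_0: "?s (t n 0) \<omega> = 1" for n \<omega>
    using assms(2,3) by (simp add: t_def stays_def start)
  have s_T: "t n (Suc n) = T" for n by (simp add: t_def)
  have telescope: "(\<Sum>i<Suc n. ?s (t n i) \<omega> - ?s (t n (Suc i)) \<omega>) = 1 - ?s T \<omega>" for n \<omega>
    using sum_lessThan_telescope'[of "\<lambda>i. ?s (t n i) \<omega>" "Suc n"] by (simp only: s_0 s_T)
  \<comment> \<open>The exit weights are nonnegative and telescope, so the bound does not grow with
    \<open>n\<close>.\<close>
  have Y_le: "\<bar>Y n \<omega>\<bar> \<le> C" for n \<omega>
  proof -
    have "\<bar>Y n \<omega>\<bar> \<le> (\<Sum>i<Suc n. (?s (t n i) \<omega> - ?s (t n (Suc i)) \<omega>) * C)"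
      unfolding Y_def
      by (intro sum_abs[THEN order_trans] sum_mono)
        (use s_antimono in \<open>auto simp: abs_mult intro!: mult_left_mono h_le\<close>)
    also have "\<dots> = (1 - ?s T \<omega>) * C"
      unfolding sum_distrib_right[symmetric] telescope ..
    also have "\<dots> \<le> C" using C by (simp add: stays_def)
    finally show ?thesis .
  qed
  have "(\<lambda>n. \<integral>\<omega>. ?D \<omega> * Y n \<omega> \<partial>M) \<longlonglongrightarrow> (\<integral>\<omega>. ?D \<omega> * 0 \<partial>M)"
  proof (rule drift_density_dominated_convergence[OF \<open>0 < T\<close> _ Y_meas])
    fix \<omega> assume "\<omega> \<in> space M"
    then show "(\<lambda>n. Y n \<omega>) \<longlonglongrightarrow> 0"
      unfolding Y_def t_def
      by (intro heat_at_grid_exit_tendsto[OF \<open>0 < T\<close> _ _ _ bounded discont odd] continuous_on_drifted)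
        (use assms(2,3) start in auto)
  qed (use Y_le in auto)
  moreover have "(\<integral>\<omega>. ?D \<omega> * Y n \<omega> \<partial>M) = (\<integral>\<omega>. ?D \<omega> * ((1 - ?s T \<omega>) * G (?X \<omega> T)) \<partial>M)" for n
  proof -
    have int: "integrable M (\<lambda>\<omega>. ?D \<omega> * ((?s (t n i) \<omega> - ?s (t n (Suc i)) \<omega>) * g \<omega>))"
      if [measurable]: "g \<in> borel_measurable M" and g: "\<And>\<omega>. \<bar>g \<omega>\<bar> \<le> C" for g i
    proof (rule integrable_drift_density_mult[OF \<open>0 < T\<close>])
      fix \<omega>
      have "\<bar>?s (t n i) \<omega> - ?s (t n (Suc i)) \<omega>\<bar> \<le> 1" by (simp add: stays_def)
      then show "\<bar>(?s (t n i) \<omega> - ?s (t n (Suc i)) \<omega>) * g \<omega>\<bar> \<le> 1 * C"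
        unfolding abs_mult by (intro mult_mono g) auto
    qed measurable
    have eq: "(\<integral>\<omega>. ?D \<omega> * ((?s (t n i) \<omega> - ?s (t n (Suc i)) \<omega>) * heat G (T - t n (Suc i)) (?X \<omega> (t n (Suc i)))) \<partial>M)
        = (\<integral>\<omega>. ?D \<omega> * ((?s (t n i) \<omega> - ?s (t n (Suc i)) \<omega>) * G (?X \<omega> T)) \<partial>M)" if "i < Suc n" for i
    proof -
      let ?Z = "\<lambda>\<omega>. G (?X \<omega> T) - heat G (T - t n (Suc i)) (?X \<omega> (t n (Suc i)))"
      have Z_int: "integrable M (\<lambda>\<omega>. ?D \<omega> * (?s (t n k) \<omega> * ?Z \<omega>))" for k
      proof (rule integrable_drift_density_mult[OF \<open>0 < T\<close>])
        fix \<omega>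
        have "\<bar>?Z \<omega>\<bar> \<le> 2 * C"
          using bounded[of "?X \<omega> T"] h_le[of "T - t n (Suc i)" "?X \<omega> (t n (Suc i))"] by simp
        then show "\<bar>?s (t n k) \<omega> * ?Z \<omega>\<bar> \<le> 1 * (2 * C)"
          unfolding abs_mult by (intro mult_mono stays_bounded) auto
      qed measurable
      \<comment> \<open>Neither horizon exceeds the evaluation time; subtracting the two cases
        isolates the slot in which the path exits.\<close>
      have zero: "(\<integral>\<omega>. ?D \<omega> * (?s (t n k) \<omega> * ?Z \<omega>) \<partial>M) = 0" if "k = i \<or> k = Suc i" for k
        using that t_mono nonneg t_le \<open>i < Suc n\<close>
        by (intro expectation_heat_stays[OF \<open>0 < T\<close> _ _ _ _ bounded]) auto
      have "(\<integral>\<omega>. ?D \<omega> * (?s (t n i) \<omega> * ?Z \<omega>) - ?D \<omega> * (?s (t n (Suc i)) \<omega> * ?Z \<omega>) \<partial>M) = 0"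
        by (subst Bochner_Integration.integral_diff) (auto simp: Z_int zero)
      also have "(\<lambda>\<omega>. ?D \<omega> * (?s (t n i) \<omega> * ?Z \<omega>) - ?D \<omega> * (?s (t n (Suc i)) \<omega> * ?Z \<omega>))
          = (\<lambda>\<omega>. ?D \<omega> * ((?s (t n i) \<omega> - ?s (t n (Suc i)) \<omega>) * G (?X \<omega> T))
              - ?D \<omega> * ((?s (t n i) \<omega> - ?s (t n (Suc i)) \<omega>) * heat G (T - t n (Suc i)) (?X \<omega> (t n (Suc i)))))"
        by (simp add: fun_eq_iff algebra_simps)
      also have "integral\<^sup>L M \<dots> = (\<integral>\<omega>. ?D \<omega> * ((?s (t n i) \<omega> - ?s (t n (Suc i)) \<omega>) * G (?X \<omega> T)) \<partial>M)
          - (\<integral>\<omega>. ?D \<omega> * ((?s (t n i) \<omega> - ?s (t n (Suc i)) \<omega>) * heat G (T - t n (Suc i)) (?X \<omega> (t n (Suc i)))) \<partial>M)"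
        by (intro Bochner_Integration.integral_diff int bounded h_le) measurable
      finally show ?thesis by simp
    qed
    have "(\<integral>\<omega>. ?D \<omega> * Y n \<omega> \<partial>M) = (\<Sum>i<Suc n.
        \<integral>\<omega>. ?D \<omega> * ((?s (t n i) \<omega> - ?s (t n (Suc i)) \<omega>) * heat G (T - t n (Suc i)) (?X \<omega> (t n (Suc i)))) \<partial>M)"
      unfolding Y_def sum_distrib_left
      by (intro Bochner_Integration.integral_sum int h_le) measurable
    also have "\<dots> = (\<Sum>i<Suc n. \<integral>\<omega>. ?D \<omega> * ((?s (t n i) \<omega> - ?s (t n (Suc i)) \<omega>) * G (?X \<omega> T)) \<partial>M)"
      by (intro sum.cong refl eq) auto
    also have "\<dots> = (\<integral>\<omega>. (\<Sum>i<Suc n. ?D \<omega> * ((?s (t n i) \<omega> - ?s (t n (Suc i)) \<omega>) * G (?X \<omega> T))) \<partial>M)"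
      by (intro Bochner_Integration.integral_sum[symmetric] int bounded) measurable
    also have "\<dots> = (\<integral>\<omega>. ?D \<omega> * ((1 - ?s T \<omega>) * G (?X \<omega> T)) \<partial>M)"
      unfolding sum_distrib_left[symmetric] sum_distrib_right[symmetric] telescope ..
    finally show ?thesis .
  qed
  ultimately have "(\<integral>\<omega>. ?D \<omega> * ((1 - ?s T \<omega>) * G (?X \<omega> T)) \<partial>M) = 0"
    by (simp add: LIMSEQ_const_iff)
  moreover have "integrable M (\<lambda>\<omega>. ?D \<omega> * (?s T \<omega> * G (?X \<omega> T)))"
  proof (rule integrable_drift_density_mult[OF \<open>0 < T\<close>])
    show "\<bar>?s T \<omega> * G (?X \<omega> T)\<bar> \<le> 1 * C" for \<omega>
      unfolding abs_mult by (intro mult_mono bounded stays_bounded) auto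
  qed measurable
  moreover have G_int: "integrable M (\<lambda>\<omega>. ?D \<omega> * G (?X \<omega> T))"
    by (rule integrable_drift_density_mult[OF \<open>0 < T\<close>, of _ C]) (use bounded in auto)
  ultimately have "(\<integral>\<omega>. ?D \<omega> * (?s T \<omega> * G (?X \<omega> T)) \<partial>M) = (\<integral>\<omega>. ?D \<omega> * G (?X \<omega> T) \<partial>M)"
    by (simp add: left_diff_distrib right_diff_distrib)
  also have "\<dots> = (\<integral>v. G (sqrt T * v - m * T + m * T) \<partial>std_normal_distribution)"
    using integral_drift_increment[of 0 T "\<lambda>x. G (x + m * T)" m] \<open>0 < T\<close>
    by (simp add: drift_density_def drifted_def)
  also have "\<dots> = heat G T 0" by (simp add: heat_def)
  finally show ?thesis .
qed

end

section \<open>The image series\<close>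

text \<open>Termwise integration works because at each point at most one translate is nonzero, so
  partial sums of absolute values stay below \<open>C\<close>. \<open>int_decode\<close> turns the
  sum into a series over \<open>nat\<close>; absolute summability then returns the unordered
  sum.\<close>

lemma has_sum_integral_periodize:
  fixes p :: real
  assumes "p > 0" "y \<le> z + p" and zero: "\<And>x. x \<le> z \<or> y \<le> x \<Longrightarrow> g x = 0"
    and [measurable]: "g \<in> borel_measurable borel" "h \<in> borel_measurable borel"
    and bounded: "\<And>x. \<bar>g x\<bar> \<le> C"
  shows "((\<lambda>k::int. \<integral>v. g (h v + p * k) \<partial>std_normal_distribution) has_sum
      (\<integral>v. periodize p z g (h v) \<partial>std_normal_distribution)) UNIV"
proof -
  define f where "f n v = g (h v + p * of_int (int_decode n))" for n v
  have sums: "(\<lambda>n. q (x + p * of_int (int_decode n))) sums periodize p z q x"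
    if "\<And>x. x \<le> z \<or> y \<le> x \<Longrightarrow> q x = 0" for x and q :: "real \<Rightarrow> real"
    using has_sum_periodize[of p y z q x] assms(1,2) that
      has_sum_reindex_bij_betw[OF bij_int_decode, where f="\<lambda>k. q (x + p * of_int k)"]
    by (intro has_sum_imp_sums) simp
  have f_sums: "(\<lambda>n. f n v) sums periodize p z g (h v)" for v
    unfolding f_def by (rule sums) (rule zero)
  have abs_sums: "(\<lambda>n. norm (f n v)) sums periodize p z (\<lambda>x. \<bar>g x\<bar>) (h v)" for v
    unfolding f_def real_norm_def by (rule sums) (simp add: zero)
  have partial_le: "(\<Sum>n<N. norm (f n v)) \<le> C" for N v
  proof -
    have "(\<Sum>n<N. norm (f n v)) \<le> periodize p z (\<lambda>x. \<bar>g x\<bar>) (h v)"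
      using sum_le_suminf[OF sums_summable[OF abs_sums], of "{..<N}" v] sums_unique[OF abs_sums, of v] by simp
    also have "\<dots> \<le> C" using bounded by (simp add: periodize_def)
    finally show ?thesis .
  qed
  have f_int: "integrable std_normal_distribution (f n)" for n
    unfolding f_def by (rule integrable_std_normal_distribution_bounded[of _ C]) (use bounded in auto)
  have summable_int: "summable (\<lambda>n. \<integral>v. norm (f n v) \<partial>std_normal_distribution)"
  proof (rule bounded_imp_summable)
    fix N
    have "(\<Sum>n\<le>N. \<integral>v. norm (f n v) \<partial>std_normal_distribution)
        = (\<integral>v. (\<Sum>n<Suc N. norm (f n v)) \<partial>std_normal_distribution)"
      using f_int by (subst Bochner_Integration.integral_sum) (auto simp: lessThan_Suc_atMost)
    also have "\<dots> \<le> (\<integral>v. C \<partial>std_normal_distribution)"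
      using f_int by (intro integral_mono partial_le Bochner_Integration.integrable_sum integrable_norm) auto
    also have "\<dots> = C" by (rule integral_std_normal_distribution_const)
    finally show "(\<Sum>n\<le>N. \<integral>v. norm (f n v) \<partial>std_normal_distribution) \<le> C" .
  qed simp
  have "(\<lambda>n. \<integral>v. f n v \<partial>std_normal_distribution) sums (\<integral>v. (\<Sum>n. f n v) \<partial>std_normal_distribution)"
    using sums_summable[OF abs_sums] by (intro sums_integral f_int summable_int AE_I2) auto
  also have "(\<lambda>v. \<Sum>n. f n v) = (\<lambda>v. periodize p z g (h v))"
    using sums_unique[OF f_sums] by simp
  finally have "((\<lambda>n. \<integral>v. f n v \<partial>std_normal_distribution) has_sum
      (\<integral>v. periodize p z g (h v) \<partial>std_normal_distribution)) UNIV"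
    by (intro norm_summable_imp_has_sum summable_comparison_test[OF _ summable_int])
      (auto intro!: exI[of _ 0] integral_abs_bound)
  then show ?thesis
    unfolding f_def
    by (simp add: has_sum_reindex_bij_betw[OF bij_int_decode,
          where f="\<lambda>k. \<integral>v. g (h v + p * of_int k) \<partial>std_normal_distribution"])
qed

lemma has_sum_heat_odd_extension:
  assumes "z < y" and zero: "\<And>x. x \<le> z \<or> y \<le> x \<Longrightarrow> g x = 0"
    and [measurable]: "g \<in> borel_measurable borel" and bounded: "\<And>x. \<bar>g x\<bar> \<le> C"
  shows "((\<lambda>k::int. heat g T (2 * k * (y - z)) - heat g T (2 * k * (y - z) + 2 * y)) has_sum
      heat (odd_extension z y g) T 0) UNIV"
proof -
  let ?p = "2 * (y - z)"
  let ?R = "periodize ?p z g"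
  have p: "?p > 0" "y \<le> z + ?p" using \<open>z < y\<close> by auto
  have R_int: "integrable std_normal_distribution (\<lambda>v. ?R (h v))"
    if [measurable]: "h \<in> borel_measurable borel" for h
    by (rule integrable_std_normal_distribution_bounded[of _ C]) (auto simp: periodize_def intro: bounded)
  \<comment> \<open>A reflected translate becomes a heat value once the sign of \<open>v\<close> is
    changed.\<close>
  have terms: "(\<integral>v. g (sqrt T * v + ?p * k) \<partial>std_normal_distribution) = heat g T (2 * k * (y - z))"
    "(\<integral>v. g (2 * y - sqrt T * v + ?p * k) \<partial>std_normal_distribution)
      = heat g T (2 * k * (y - z) + 2 * y)" for k :: int
    using integral_std_normal_distribution_uminus[of "\<lambda>v. g (2 * y - sqrt T * v + ?p * k)"]
    by (simp_all add: heat_def algebra_simps)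
  have "((\<lambda>k::int. (\<integral>v. g (sqrt T * v + ?p * k) \<partial>std_normal_distribution)
        + - (\<integral>v. g (2 * y - sqrt T * v + ?p * k) \<partial>std_normal_distribution)) has_sum
      (\<integral>v. ?R (sqrt T * v) \<partial>std_normal_distribution) + - (\<integral>v. ?R (2 * y - sqrt T * v) \<partial>std_normal_distribution)) UNIV"
    by (intro has_sum_add has_sum_uminusI has_sum_integral_periodize[OF p zero _ _ bounded]) auto
  also have "(\<integral>v. ?R (sqrt T * v) \<partial>std_normal_distribution) + - (\<integral>v. ?R (2 * y - sqrt T * v) \<partial>std_normal_distribution)
      = heat (odd_extension z y g) T 0"
    using Bochner_Integration.integral_diff[OF R_int R_int, of "\<lambda>v. sqrt T * v" "\<lambda>v. 2 * y - sqrt T * v"]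
    by (simp add: heat_def odd_extension_def)
  finally show ?thesis unfolding terms by simp
qed

section \<open>Black-Scholes value of a single image\<close>

lemma std_normal_distribution_upper_tail:
  "measure std_normal_distribution {- c..} = \<Phi> c"
proof -
  have "(\<integral>v. indicator {- c..} v \<partial>std_normal_distribution)
      = (\<integral>v. (indicator {..c} (- v) :: real) \<partial>std_normal_distribution)"
    by (intro Bochner_Integration.integral_cong) (auto simp: indicator_def)
  also have "\<dots> = (\<integral>v. indicator {..c} v \<partial>std_normal_distribution)"
    by (rule integral_std_normal_distribution_uminus) simp
  finally show ?thesis by (simp add: cdf_def)
qed

text \<open>Here \<open>x\<close> stands for the log-return divided by \<open>\<sigma>\<close>. The
  exponential is the Girsanov factor that gives a driftless Wiener process the drift
  \<open>m\<close> up to time \<open>T\<close>.\<close>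

definition knockout_call :: "real \<Rightarrow> real \<Rightarrow> real \<Rightarrow> real \<Rightarrow> real \<Rightarrow> real \<Rightarrow> real \<Rightarrow> real \<Rightarrow> real" where
  "knockout_call z y S0 K \<sigma> m T x =
     (if z < x \<and> x < y then max (S0 * exp (\<sigma> * x) - K) 0 * exp (m * x - m\<^sup>2 / 2 * T) else 0)"

lemma borel_measurable_knockout_call [measurable]:
  "knockout_call z y S0 K \<sigma> m T \<in> borel_measurable borel"
  unfolding knockout_call_def[abs_def] by measurable

text \<open>The cut-off at \<open>y\<close> tames the unbounded call payoff; the constant is
  crude.\<close>

lemma knockout_call_bounded:
  assumes "0 < S0" "0 < K" "0 < \<sigma>" "0 \<le> T"
  shows "\<bar>knockout_call z y S0 K \<sigma> m T x\<bar> \<le> S0 * exp (\<sigma> * y) * exp (\<bar>m\<bar> * (\<bar>z\<bar> + \<bar>y\<bar>))"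
proof (cases "z < x \<and> x < y")
  case True
  have "S0 * exp (\<sigma> * x) \<le> S0 * exp (\<sigma> * y)" using True assms by simp
  moreover have "0 < S0 * exp (\<sigma> * y)" using assms by simp
  ultimately have "max (S0 * exp (\<sigma> * x) - K) 0 \<le> S0 * exp (\<sigma> * y)" using assms(2) by simp
  moreover have "m * x \<le> \<bar>m\<bar> * \<bar>x\<bar>" by (metis abs_ge_self abs_mult)
  moreover have "\<bar>m\<bar> * \<bar>x\<bar> \<le> \<bar>m\<bar> * (\<bar>z\<bar> + \<bar>y\<bar>)" using True by (intro mult_left_mono) auto
  moreover have "0 \<le> m\<^sup>2 / 2 * T" using assms by simp
  ultimately show ?thesis
    using True by (simp add: knockout_call_def abs_mult) (intro mult_mono, auto)
next
  case False
  then have "knockout_call z y S0 K \<sigma> m T x = 0" by (auto simp: knockout_call_def)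
  then show ?thesis using assms by simp
qed

lemma countable_discontinuities_knockout_call:
  "countable {x. \<not> isCont (knockout_call z y S0 K \<sigma> m T) x}"
proof (rule countable_subset)
  show "countable {z, y}" by simp
  show "{x. \<not> isCont (knockout_call z y S0 K \<sigma> m T) x} \<subseteq> {z, y}"
  proof (rule subsetI, rule ccontr)
    fix x assume x: "x \<in> {x. \<not> isCont (knockout_call z y S0 K \<sigma> m T) x}" and "x \<notin> {z, y}"
    then consider "x \<in> {z<..<y}" | "x \<in> {..<z} \<union> {y<..}" by force
    then show False
    proof cases
      case 1
      then have "\<forall>\<^sub>F u in nhds x. u \<in> {z<..<y}" by (intro eventually_nhds_in_open) auto
      then have "\<forall>\<^sub>F u in nhds x. knockout_call z y S0 K \<sigma> m T u
          = max (S0 * exp (\<sigma> * u) - K) 0 * exp (m * u - m\<^sup>2 / 2 * T)"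
        by eventually_elim (simp add: knockout_call_def)
      then have "isCont (knockout_call z y S0 K \<sigma> m T) x \<longleftrightarrow>
          isCont (\<lambda>u. max (S0 * exp (\<sigma> * u) - K) 0 * exp (m * u - m\<^sup>2 / 2 * T)) x"
        by (rule isCont_cong)
      then show False using x by (auto intro!: continuous_intros)
    next
      case 2
      then have "\<forall>\<^sub>F u in nhds x. u \<in> {..<z} \<union> {y<..}"
        by (intro eventually_nhds_in_open open_Un) auto
      then have "\<forall>\<^sub>F u in nhds x. knockout_call z y S0 K \<sigma> m T u = 0"
        by eventually_elim (auto simp: knockout_call_def)
      then show False using x by (simp add: isCont_cong)
    qed
  qed
qed

text \<open>
  Below \<open>K\<close> the call payoff vanishes, so only the upper barrier \<open>U\<close> truncates it: for \<open>s \<ge> U\<close> the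
  difference of the calls struck at \<open>K\<close> and \<open>U\<close> is the constant \<open>U - K\<close>.
\<close>

lemma heat_knockout_call:
  fixes a r :: real
  assumes "0 < T" "0 < \<sigma>" "0 < S0" and U: "S0 * exp (\<sigma> * y) = U" and L: "S0 * exp (\<sigma> * z) = L"
    and "L < K" "K < U"
  defines "m \<equiv> r / \<sigma> - \<sigma> / 2"
  shows "exp (- r * T) * heat (knockout_call z y S0 K \<sigma> m T) T a
    = exp (m * a) * (C_BS (exp (\<sigma> * a) * S0) K T r \<sigma> - C_BS (exp (\<sigma> * a) * S0) U T r \<sigma>
        - exp (- r * T) * (U - K) * \<Phi> ((a - y + m * T) / sqrt T))"
proof -
  \<comment> \<open>\<open>b\<close> is the translation that absorbs the tilt; \<open>- c\<close>
    will be the value of \<open>v\<close> from which \<open>S v\<close> is at least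
    \<open>U\<close>.\<close>
  define b where "b = m * sqrt T"
  define c where "c = (a - y + m * T) / sqrt T"
  define q where "q u = (if z < u \<and> u < y then max (S0 * exp (\<sigma> * u) - K) 0 else 0)" for u
  define S where "S v = exp (\<sigma> * a) * S0 * exp ((r - \<sigma>\<^sup>2 / 2) * T + \<sigma> * sqrt T * v)" for v
  have [measurable]: "q \<in> borel_measurable borel" unfolding q_def[abs_def] by measurable
  have sqrt: "sqrt T * sqrt T = T" "sqrt T > 0" using \<open>0 < T\<close> by auto
  \<comment> \<open>\<open>\<sigma> * m\<close> is the risk-neutral drift of the log price, and
    starting the heat flow at \<open>a\<close> amounts to starting the asset at
    \<open>exp (\<sigma> * a) * S0\<close>.\<close>
  have S_eq: "S v = S0 * exp (\<sigma> * (a + sqrt T * (v + b)))" for v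
  proof -
    have "\<sigma> * m = r - \<sigma>\<^sup>2 / 2" using \<open>0 < \<sigma>\<close> by (simp add: m_def field_simps power2_eq_square)
    moreover have "sqrt T * b = m * T" using sqrt(1) by (simp add: b_def)
    then have "\<sigma> * (a + sqrt T * (v + b)) = \<sigma> * a + (\<sigma> * m * T + \<sigma> * sqrt T * v)"
      by (simp add: distrib_left mult.assoc)
    ultimately have "\<sigma> * (a + sqrt T * (v + b)) = \<sigma> * a + ((r - \<sigma>\<^sup>2 / 2) * T + \<sigma> * sqrt T * v)"
      by simp
    then show ?thesis by (simp add: S_def exp_add mult_ac)
  qed
  have "heat (knockout_call z y S0 K \<sigma> m T) T a
      = (\<integral>v. exp (m * a) * (exp (b * v - b\<^sup>2 / 2) * q (a + sqrt T * v)) \<partial>std_normal_distribution)"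
    unfolding heat_def
  proof (intro Bochner_Integration.integral_cong refl)
    fix v
    have "m * (a + sqrt T * v) - m\<^sup>2 / 2 * T = m * a + (b * v - b\<^sup>2 / 2)"
      using \<open>0 < T\<close> by (simp add: b_def power_mult_distrib algebra_simps)
    then show "knockout_call z y S0 K \<sigma> m T (a + sqrt T * v)
        = exp (m * a) * (exp (b * v - b\<^sup>2 / 2) * q (a + sqrt T * v))"
      by (simp add: knockout_call_def q_def exp_add)
  qed
  also have "\<dots> = exp (m * a) * (\<integral>v. q (a + sqrt T * (v + b)) \<partial>std_normal_distribution)"
    using integral_std_normal_distribution_tilt[of "\<lambda>v. q (a + sqrt T * v)" b] by simp
  also have "(\<lambda>v. q (a + sqrt T * (v + b)))
      = (\<lambda>v. max (S v - K) 0 - max (S v - U) 0 - (U - K) * indicator {- c..} v)"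
  proof
    fix v
    define u where "u = a + sqrt T * (v + b)"
    have mono: "S0 * exp (\<sigma> * x) < S0 * exp (\<sigma> * x') \<longleftrightarrow> x < x'" for x x'
      using \<open>0 < S0\<close> \<open>0 < \<sigma>\<close> by simp
    have "z < u \<longleftrightarrow> L < S v" "u < y \<longleftrightarrow> S v < U"
      unfolding S_eq u_def[symmetric] using mono[of z u] mono[of u y] by (simp_all only: U L)
    moreover have "v \<in> {- c..} \<longleftrightarrow> y \<le> u"
    proof -
      have "c * sqrt T = a - y + m * T" using sqrt(2) by (simp add: c_def)
      moreover have "u = a + v * sqrt T + m * T"
        using sqrt(1) by (simp add: u_def b_def algebra_simps)
      ultimately have "y \<le> u \<longleftrightarrow> - c * sqrt T \<le> v * sqrt T" by auto
      also have "\<dots> \<longleftrightarrow> - c \<le> v" by (rule mult_le_cancel_right_pos[OF sqrt(2)])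
      finally show ?thesis by simp
    qed
    ultimately show "q (a + sqrt T * (v + b))
        = max (S v - K) 0 - max (S v - U) 0 - (U - K) * indicator {- c..} v"
      using \<open>L < K\<close> \<open>K < U\<close> by (auto simp: q_def S_eq u_def[symmetric] indicator_def max_def)
  qed
  also have "(\<integral>v. max (S v - K) 0 - max (S v - U) 0 - (U - K) * indicator {- c..} v \<partial>std_normal_distribution)
      = (\<integral>v. max (S v - K) 0 \<partial>std_normal_distribution) - (\<integral>v. max (S v - U) 0 \<partial>std_normal_distribution)
        - (U - K) * \<Phi> c"
  proof -
    have "0 < S0 * exp (\<sigma> * z)" using \<open>0 < S0\<close> by simp
    then have "0 < L" using L by simp
    have S_meas [measurable]: "S \<in> borel_measurable borel" unfolding S_def[abs_def] by measurable
    have "S = (\<lambda>v. (exp (\<sigma> * a) * S0 * exp ((r - \<sigma>\<^sup>2 / 2) * T)) * exp (\<sigma> * sqrt T * v))"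
      by (simp add: S_def fun_eq_iff exp_add)
    then have S_int: "integrable std_normal_distribution S"
      using integrable_std_normal_distribution_exp[of "\<sigma> * sqrt T"] by simp
    have S_pos: "0 < S v" for v using \<open>0 < S0\<close> by (simp add: S_def)
    have int: "integrable std_normal_distribution (\<lambda>v. max (S v - k) 0)" if "0 < k" for k
      using S_int that by (rule_tac Bochner_Integration.integrable_bound) (auto intro!: AE_I2 simp: less_imp_le[OF S_pos])
    have "integrable std_normal_distribution (indicator {- c..} :: real \<Rightarrow> real)"
      by (rule integrable_std_normal_distribution_bounded[of _ 1]) (auto simp: indicator_def)
    then show ?thesis
      using int[of K] int[of U] \<open>0 < L\<close> \<open>L < K\<close> \<open>K < U\<close>
      by (simp add: std_normal_distribution_upper_tail)
  qed
  moreover have "C_BS (exp (\<sigma> * a) * S0) k T r \<sigma>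
      = exp (- r * T) * (\<integral>v. max (S v - k) 0 \<partial>std_normal_distribution)" for k
    by (simp add: C_BS_def S_def)
  ultimately show ?thesis
    unfolding c_def[symmetric] by (simp only:) (simp add: algebra_simps)
qed

text \<open>By compactness the extrema are attained, so strict inequalities at every time remain
  strict for them.\<close>

lemma stays_iff_INF_SUP:
  fixes x :: "real \<Rightarrow> real"
  assumes cont: "continuous_on {0..t} x" and "0 \<le> t"
  shows "(\<forall>u\<in>{0..t}. x u \<in> {L<..<U}) \<longleftrightarrow> L < (INF u\<in>{0..t}. x u) \<and> (SUP u\<in>{0..t}. x u) < U"
proof -
  have ne: "{0..t} \<noteq> {}" using \<open>0 \<le> t\<close> by simp
  obtain a where a: "a \<in> {0..t}" "\<And>u. u \<in> {0..t} \<Longrightarrow> x a \<le> x u"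
    using continuous_attains_inf[OF compact_Icc ne cont] by auto
  obtain b where b: "b \<in> {0..t}" "\<And>u. u \<in> {0..t} \<Longrightarrow> x u \<le> x b"
    using continuous_attains_sup[OF compact_Icc ne cont] by auto
  have eq: "(INF u\<in>{0..t}. x u) = x a" "(SUP u\<in>{0..t}. x u) = x b"
    using a b by (auto intro!: cInf_eq_minimum cSup_eq_maximum)
  show ?thesis
    unfolding eq greaterThanLessThan_iff using a b by (meson le_less_trans less_le_trans)
qed

section \<open>The double-barrier call\<close>

lemma continuous_on_bs_asset:
  assumes "wiener_process P W" "\<omega> \<in> space P"
  shows "continuous_on {0..t} (\<lambda>u. bs_asset S0 \<mu> \<sigma> W u \<omega>)"
  unfolding bs_asset_def
  using continuous_on_subset[OF wiener_process.continuous_paths[OF assms], of "{0..t}"]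
  by (intro continuous_intros) auto

lemma borel_measurable_bs_asset:
  assumes "wiener_process P W" "0 \<le> t"
  shows "(\<lambda>\<omega>. bs_asset S0 \<mu> \<sigma> W t \<omega>) \<in> borel_measurable P"
  using wiener_process.random_variable[OF assms] unfolding bs_asset_def by measurable

lemma double_barrier_call_payoff_stays:
  assumes "wiener_process P W" "\<omega> \<in> space P" "0 \<le> T"
  shows "double_barrier_call_payoff (bs_asset S0 \<mu> \<sigma> W) L U K T \<omega>
    = max (bs_asset S0 \<mu> \<sigma> W T \<omega> - K) 0 * stays {L<..<U} T (\<lambda>t. bs_asset S0 \<mu> \<sigma> W t \<omega>)"
  using stays_iff_INF_SUP[OF continuous_on_bs_asset[OF assms(1,2)] assms(3), of S0 \<mu> \<sigma> L U]
  by (simp add: double_barrier_call_payoff_def stays_def indicator_def)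

text \<open>Two drifts occur: \<open>n\<close> is that of the real-world path, \<open>m\<close> the
  risk-neutral one. The integral is carried back to \<open>P\<close>, where the path has drift
  \<open>n\<close>.\<close>

lemma price_double_barrier_call:
  fixes P :: "'a measure" and r :: real
  assumes "wiener_process P W"
    and "0 < T" "0 < \<sigma>" "0 < S0" and U: "S0 * exp (\<sigma> * y) = U" and L: "S0 * exp (\<sigma> * z) = L"
    and "L < S0" "S0 < U" "L < K"
  defines "m \<equiv> r / \<sigma> - \<sigma> / 2"
  shows "price (risk_neutral_measure P W \<mu> \<sigma> r T) r T (double_barrier_call_payoff (bs_asset S0 \<mu> \<sigma> W) L U K T)
    = exp (- r * T) * heat (odd_extension z y (knockout_call z y S0 K \<sigma> m T)) T 0"
proof -
  interpret wiener_process P W by fact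
  define n where "n = \<mu> / \<sigma> - \<sigma> / 2"
  define g where "g = knockout_call z y S0 K \<sigma> m T"
  define G where "G = odd_extension z y g"
  define \<theta> where "\<theta> = (r - \<mu>) / \<sigma>"
  define R where "R \<omega> = exp (\<theta> * W T \<omega> - 1 / 2 * \<theta>\<^sup>2 * T)" for \<omega>
  let ?payoff = "double_barrier_call_payoff (bs_asset S0 \<mu> \<sigma> W) L U K T"
  have mono: "S0 * exp (\<sigma> * x) < S0 * exp (\<sigma> * x') \<longleftrightarrow> x < x'" for x x'
    using \<open>0 < S0\<close> \<open>0 < \<sigma>\<close> by simp
  have above: "L < S0 * exp (\<sigma> * x) \<longleftrightarrow> z < x" for x using mono[of z x] by (simp only: L)
  have below: "S0 * exp (\<sigma> * x) < U \<longleftrightarrow> x < y" for x using mono[of x y] by (simp only: U)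
  have zy: "z < 0" "0 < y" using above[of 0] below[of 0] \<open>L < S0\<close> \<open>S0 < U\<close> by auto
  have "0 < S0 * exp (\<sigma> * z)" using \<open>0 < S0\<close> by simp
  then have "0 < K" using L \<open>L < K\<close> by simp
  have g_meas [measurable]: "g \<in> borel_measurable borel" unfolding g_def by simp
  obtain C where g_le: "\<And>x. \<bar>g x\<bar> \<le> C"
    using knockout_call_bounded[of S0 K \<sigma> T z y m] \<open>0 < K\<close> assms(2-4) unfolding g_def by fastforce
  have g_zero: "g x = 0" if "x \<le> z \<or> y \<le> x" for x
    using that by (auto simp: g_def knockout_call_def)
  have T: "0 \<le> T" using \<open>0 < T\<close> by simp
  have W_T [measurable]: "W T \<in> borel_measurable P" using T by (rule random_variable)
  have payoff_meas [measurable]: "?payoff \<in> borel_measurable P"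
  proof (rule measurable_cong[THEN iffD1, OF double_barrier_call_payoff_stays[symmetric]])
    have [measurable]: "(\<lambda>\<omega>. bs_asset S0 \<mu> \<sigma> W T \<omega>) \<in> borel_measurable P"
      "(\<lambda>\<omega>. stays {L<..<U} T (\<lambda>t. bs_asset S0 \<mu> \<sigma> W t \<omega>)) \<in> borel_measurable P"
      using T by (intro borel_measurable_bs_asset borel_measurable_stays_open continuous_on_bs_asset assms(1); simp)+
    show "(\<lambda>\<omega>. max (bs_asset S0 \<mu> \<sigma> W T \<omega> - K) 0 * stays {L<..<U} T (\<lambda>t. bs_asset S0 \<mu> \<sigma> W t \<omega>))
        \<in> borel_measurable P" by measurable
  qed (use assms(1) T in auto)
  have R_meas [measurable]: "R \<in> borel_measurable P" unfolding R_def[abs_def] by measurable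
  have "(\<integral>\<omega>. ?payoff \<omega> \<partial>risk_neutral_measure P W \<mu> \<sigma> r T) = (\<integral>\<omega>. R \<omega> * ?payoff \<omega> \<partial>P)"
    unfolding risk_neutral_measure_def \<theta>_def[symmetric] R_def[symmetric]
    by (subst integral_density[OF payoff_meas R_meas]) (auto simp: R_def)
  also have "\<dots> = (\<integral>\<omega>. drift_density W n T \<omega> *
      (stays {z<..<y} T (drifted W n \<omega>) * G (drifted W n \<omega> T)) \<partial>P)"
  proof (rule integral_cong_AE)
    show "(\<lambda>\<omega>. R \<omega> * ?payoff \<omega>) \<in> borel_measurable P" by measurable
    have [measurable]: "drift_density W n T \<in> borel_measurable P"
      "(\<lambda>\<omega>. drifted W n \<omega> T) \<in> borel_measurable P"
      "(\<lambda>\<omega>. stays {z<..<y} T (drifted W n \<omega>)) \<in> borel_measurable P"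
      using T by (intro borel_measurable_drift_density borel_measurable_drifted borel_measurable_stays_open
          continuous_on_drifted; simp)+
    show "(\<lambda>\<omega>. drift_density W n T \<omega> * (stays {z<..<y} T (drifted W n \<omega>) * G (drifted W n \<omega> T)))
        \<in> borel_measurable P" unfolding G_def by measurable
    \<comment> \<open>Equality holds only almost everywhere, as \<open>R\<close> and the asset
      contain \<open>W\<close> itself while the drifted path subtracts \<open>W 0\<close>.\<close>
    show "AE \<omega> in P. R \<omega> * ?payoff \<omega> = drift_density W n T \<omega> *
        (stays {z<..<y} T (drifted W n \<omega>) * G (drifted W n \<omega> T))"
      using start_zero AE_space
    proof eventually_elim
      case (elim \<omega>)
      have S: "bs_asset S0 \<mu> \<sigma> W t \<omega> = S0 * exp (\<sigma> * drifted W n \<omega> t)" for t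
        using elim \<open>0 < \<sigma>\<close> by (simp add: bs_asset_def drifted_def n_def field_simps power2_eq_square)
      have payoff: "?payoff \<omega> = max (S0 * exp (\<sigma> * drifted W n \<omega> T) - K) 0
          * stays {z<..<y} T (drifted W n \<omega>)"
        unfolding double_barrier_call_payoff_stays[OF assms(1) elim(2) T] S
        by (simp add: stays_def above below)
      show ?case
      proof (cases "\<forall>u\<in>{0..T}. drifted W n \<omega> u \<in> {z<..<y}")
        case True
        define x where "x = drifted W n \<omega> T"
        have x: "z < x" "x < y" using True T by (auto simp: x_def)
        have W: "W T \<omega> = x - n * T" using elim by (simp add: x_def drifted_def)
        \<comment> \<open>Since \<open>\<theta> = m - n\<close>, the mixed terms of the square
          cancel: one factor removes the drift \<open>n\<close>, the other inserts
          \<open>m\<close>.\<close>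
        have "R \<omega> = drift_density W n T \<omega> * exp (m * x - m\<^sup>2 / 2 * T)"
        proof -
          have \<theta>: "\<theta> = m - n" by (simp add: \<theta>_def m_def n_def diff_divide_distrib)
          have "\<theta> * (x - n * T) - 1 / 2 * \<theta>\<^sup>2 * T
              = - n * (x - n * T) - n\<^sup>2 / 2 * T + (m * x - m\<^sup>2 / 2 * T)"
            by (simp add: \<theta> power2_eq_square field_simps)
          then show ?thesis
            using elim by (simp add: R_def drift_density_def W flip: exp_add)
        qed
        \<comment> \<open>A path that stayed inside ends inside, where \<open>G\<close> agrees with
          \<open>g\<close>.\<close>
        moreover have "G x = max (S0 * exp (\<sigma> * x) - K) 0 * exp (m * x - m\<^sup>2 / 2 * T)"
          using x by (simp add: G_def odd_extension_inside g_zero) (simp add: g_def knockout_call_def)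
        ultimately show ?thesis by (simp add: payoff x_def)
      next
        case False
        have "stays {z<..<y} T (drifted W n \<omega>) = 0"
          unfolding stays_def by (rule if_not_P[OF False])
        then show ?thesis by (simp add: payoff)
      qed
    qed
  qed
  also have "\<dots> = heat G T 0"
  proof (rule expectation_stays_odd[OF \<open>0 < T\<close> zy])
    show "G \<in> borel_measurable borel" unfolding G_def by simp
    show "\<bar>G x\<bar> \<le> 2 * C" for x unfolding G_def by (rule odd_extension_bounded) (rule g_le)
    show "countable {x. \<not> isCont G x}"
      unfolding G_def g_def using zy
      by (intro countable_discontinuities_odd_extension countable_discontinuities_knockout_call) simp
    show "G (2 * z - x) = - G x" "G (2 * y - x) = - G x" for x
      unfolding G_def using zy by (auto intro: odd_extension_reflect_lower odd_extension_reflect_upper)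
  qed
  finally show ?thesis by (simp add: price_def G_def g_def)
qed

text \<open>\<open>has_sum\<close> over all integers is unordered convergence, for real terms the
  same as absolute convergence, so every way of taking two-sided partial sums is covered.\<close>

theorem theorem4p1:
  fixes P :: "'a measure" and W1 :: "real \<Rightarrow> 'a \<Rightarrow> real"
    and S0 L U K T \<mu> \<sigma> r y z :: real
  assumes "wiener_process P W1"
    and "T > 0" and "\<sigma> > 0"
    and "0 < L" and "L < U" and "L < K" and "K < U" and "L < S0" and "S0 < U"
    and "y = 1 / \<sigma> * ln (U / S0)" and "z = 1 / \<sigma> * ln (L / S0)"
  shows "((\<lambda>k::int.
      exp ((r / \<sigma> - 1 / 2 * \<sigma>) * (2 * k * (y - z))) *
        (C_BS (exp (2 * k * \<sigma> * (y - z)) * S0) K T r \<sigma>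
         - C_BS (exp (2 * k * \<sigma> * (y - z)) * S0) U T r \<sigma>
         - exp (- r * T) * (U - K) *
             \<Phi> ((2 * k * (y - z) - y + (r / \<sigma> - \<sigma> / 2) * T) / sqrt T))
      - exp ((r / \<sigma> - 1 / 2 * \<sigma>) * (2 * k * (y - z) + 2 * y)) *
        (C_BS (exp (2 * \<sigma> * (k * (y - z) + y)) * S0) K T r \<sigma>
         - C_BS (exp (2 * \<sigma> * (k * (y - z) + y)) * S0) U T r \<sigma>
         - exp (- r * T) * (U - K) *
             \<Phi> ((2 * k * (y - z) + y + (r / \<sigma> - \<sigma> / 2) * T) / sqrt T)))
    has_sum
      price (risk_neutral_measure P W1 \<mu> \<sigma> r T) r T
        (double_barrier_call_payoff (bs_asset S0 \<mu> \<sigma> W1) L U K T)) UNIV"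
proof -
  define m where "m = r / \<sigma> - \<sigma> / 2"
  define g where "g = knockout_call z y S0 K \<sigma> m T"
  have "0 < S0" "0 < U" "0 < K" using assms by auto
  then have U: "S0 * exp (\<sigma> * y) = U" and L: "S0 * exp (\<sigma> * z) = L"
    using assms by auto
  have "S0 * exp (\<sigma> * z) < S0 * exp (\<sigma> * y)" using U L \<open>L < U\<close> by simp
  then have "z < y" using \<open>0 < S0\<close> \<open>\<sigma> > 0\<close> by simp
  have series: "((\<lambda>k::int. heat g T (2 * k * (y - z)) - heat g T (2 * k * (y - z) + 2 * y)) has_sum
      heat (odd_extension z y g) T 0) UNIV"
    unfolding g_def
  proof (rule has_sum_heat_odd_extension[OF \<open>z < y\<close>])
    show "\<bar>knockout_call z y S0 K \<sigma> m T x\<bar> \<le> S0 * exp (\<sigma> * y) * exp (\<bar>m\<bar> * (\<bar>z\<bar> + \<bar>y\<bar>))" for x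
      using \<open>0 < S0\<close> \<open>0 < K\<close> assms by (intro knockout_call_bounded) auto
  qed (auto simp: knockout_call_def)
  have term_eq: "exp (- r * T) * heat g T a
    = exp (m * a) * (C_BS (exp (\<sigma> * a) * S0) K T r \<sigma> - C_BS (exp (\<sigma> * a) * S0) U T r \<sigma>
        - exp (- r * T) * (U - K) * \<Phi> ((a - y + m * T) / sqrt T))" for a
    unfolding g_def m_def
    by (rule heat_knockout_call[OF \<open>T > 0\<close> \<open>\<sigma> > 0\<close> \<open>0 < S0\<close> U L \<open>L < K\<close> \<open>K < U\<close>])
  have price_eq: "price (risk_neutral_measure P W1 \<mu> \<sigma> r T) r T
      (double_barrier_call_payoff (bs_asset S0 \<mu> \<sigma> W1) L U K T)
    = exp (- r * T) * heat (odd_extension z y g) T 0"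
    unfolding g_def m_def
    by (rule price_double_barrier_call[OF assms(1) \<open>T > 0\<close> \<open>\<sigma> > 0\<close> \<open>0 < S0\<close> U L
          \<open>L < S0\<close> \<open>S0 < U\<close> \<open>L < K\<close>])
  \<comment> \<open>The two halves of a term are \<open>term_eq\<close> at
    \<open>a = 2 * k * (y - z)\<close> and at that value plus \<open>2 * y\<close>; in the second,
    \<open>a - y\<close> leaves \<open>+ y\<close> inside \<open>\<Phi>\<close>.\<close>
  have exponents: "r / \<sigma> - 1 / 2 * \<sigma> = m" "r / \<sigma> - \<sigma> / 2 = m"
    "2 * k * \<sigma> * (y - z) = \<sigma> * (2 * k * (y - z))"
    "2 * \<sigma> * (k * (y - z) + y) = \<sigma> * (2 * k * (y - z) + 2 * y)"
    "2 * k * (y - z) + y = 2 * k * (y - z) + 2 * y - y" for k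
    by (simp_all add: m_def algebra_simps)
  show ?thesis
    unfolding price_eq exponents term_eq[symmetric] right_diff_distrib[symmetric]
    by (intro has_sum_cmult_right series)
qed

end
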